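(* Let $\mathbb{G}$ be a compact quantum group described by a $C^*$-algebra $\mathrm{C}(\mathbb{G})$ (a completion of $\mathrm{Pol}(\mathbb{G})$ in a quantum group norm), embedded in $\mathrm{B}(H)$ for some Hilbert space $H$, and let $\pi:\mathrm{Pol}(\mathbb{G})\to\mathrm{B}(H)$ be the representation given by the inclusion $\mathrm{Pol}(\mathbb{G})\hookrightarrow\mathrm{C}(\mathbb{G})\subset\mathrm{B}(H)$. Let $\widetilde\pi=\pi\oplus\varepsilon:\mathrm{Pol}(\mathbb{G})\to\mathrm{B}(H\oplus\mathbb{C})$ and $$\|a\|_{\widetilde\pi}=\|\widetilde\pi(a)\|=\max\{\|\pi(a)\|,|\varepsilon(a)|\},\qquad a\in\mathrm{Pol}(\mathbb{G}).$$ Then the $C^*$-norm $\|\cdot\|_{\widetilde\pi}$ on $\mathrm{Pol}(\mathbb{G})$ is a quantum group norm.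
   Context: $\mathrm{Pol}(\mathbb{G})$ is the Hopf $*$-algebra spanned by matrix elements of finite-dimensional corepresentations of $\mathbb{G}$, with comultiplication $\Delta$ and counit $\varepsilon$. A $C^*$-norm $\|\cdot\|_\sim$ on $\mathrm{Pol}(\mathbb{G})$, with completion $\mathrm{C}(\mathbb{G}_\sim)$, is a quantum group norm if $\Delta:\mathrm{Pol}(\mathbb{G})\to\mathrm{Pol}(\mathbb{G})\otimes_{\mathrm{alg}}\mathrm{Pol}(\mathbb{G})$ extends to a $*$-homomorphism $\mathrm{C}(\mathbb{G}_\sim)\to\mathrm{C}(\mathbb{G}_\sim)\otimes\mathrm{C}(\mathbb{G}_\sim)$ (spatial tensor product). *)

theory Defs
  imports "HOL-Analysis.Analysis" "HOL-Library.Multiset"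
begin

section \<open>Complex vector spaces and Hilbert spaces\<close>

class complex_vector = real_vector +
  fixes scaleC :: "complex \<Rightarrow> 'a \<Rightarrow> 'a"  (infixr "*\<^sub>C" 75)
  assumes scaleC_add_right: "c *\<^sub>C (x + y) = c *\<^sub>C x + c *\<^sub>C y"
    and scaleC_add_left: "(c + d) *\<^sub>C x = c *\<^sub>C x + d *\<^sub>C x"
    and scaleC_scaleC: "c *\<^sub>C d *\<^sub>C x = (c * d) *\<^sub>C x"
    and scaleC_one: "1 *\<^sub>C x = x"
    and scaleR_scaleC: "r *\<^sub>R x = complex_of_real r *\<^sub>C x"

global_interpretation cvec: vector_space "scaleC :: complex \<Rightarrow> 'a \<Rightarrow> 'a::complex_vector"
  by unfold_locales
    (simp_all add: scaleC_add_right scaleC_add_left scaleC_scaleC scaleC_one)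

abbreviation clinear :: "('a::complex_vector \<Rightarrow> 'b::complex_vector) \<Rightarrow> bool"
  where "clinear \<equiv> Vector_Spaces.linear scaleC scaleC"

text \<open>Inner products are conjugate linear in the first argument.\<close>

class chilbert_space = complex_vector + banach +
  fixes cinner :: "'a \<Rightarrow> 'a \<Rightarrow> complex"
  assumes cinner_commute: "cinner x y = cnj (cinner y x)"
    and cinner_add_right: "cinner x (y + z) = cinner x y + cinner x z"
    and cinner_scaleC_right: "cinner x (c *\<^sub>C y) = c * cinner x y"
    and norm_eq_sqrt_cinner: "norm x = sqrt (Re (cinner x x))"

instantiation complex :: chilbert_space
begin
definition scaleC_complex :: "complex \<Rightarrow> complex \<Rightarrow> complex" where "scaleC_complex c z = c * z"
definition cinner_complex :: "complex \<Rightarrow> complex \<Rightarrow> complex" where "cinner_complex w z = cnj w * z"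
instance
  by intro_classes
    (auto simp: scaleC_complex_def cinner_complex_def algebra_simps scaleR_conv_of_real
      cmod_def power2_eq_square)
end

instantiation prod :: (complex_vector, complex_vector) complex_vector
begin
definition scaleC_prod :: "complex \<Rightarrow> 'a \<times> 'b \<Rightarrow> 'a \<times> 'b"
  where "scaleC_prod c x = (c *\<^sub>C fst x, c *\<^sub>C snd x)"
instance
  by intro_classes
    (auto simp: scaleC_prod_def scaleC_add_right scaleC_add_left scaleC_scaleC scaleC_one
      scaleR_prod_def scaleR_scaleC)
end

lemma Re_cinner_self: "Re (cinner x x) = (norm x)\<^sup>2" for x :: "'a::chilbert_space"
proof -
  have "0 \<le> sqrt (Re (cinner x x))"
    by (metis norm_eq_sqrt_cinner norm_ge_zero)
  then show ?thesis by (simp add: norm_eq_sqrt_cinner)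
qed

text \<open>The Hilbert space direct sum is the product type; its library norm is the Euclidean one.\<close>

instantiation prod :: (chilbert_space, chilbert_space) chilbert_space
begin
definition cinner_prod :: "'a \<times> 'b \<Rightarrow> 'a \<times> 'b \<Rightarrow> complex"
  where "cinner_prod x y = cinner (fst x) (fst y) + cinner (snd x) (snd y)"
instance
proof
  fix x y z :: "'a \<times> 'b" and c :: complex
  show "cinner x y = cnj (cinner y x)"
    by (simp add: cinner_prod_def) (metis cinner_commute)
  show "cinner x (y + z) = cinner x y + cinner x z"
    by (simp add: cinner_prod_def cinner_add_right)
  show "cinner x (c *\<^sub>C y) = c * cinner x y"
    by (simp add: cinner_prod_def scaleC_prod_def cinner_scaleC_right distrib_left)
  show "norm x = sqrt (Re (cinner x x))"
    by (simp add: cinner_prod_def norm_prod_def Re_cinner_self)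
qed
end


section \<open>The Hilbert space of square summable families\<close>

typedef 'i ell2 = "{f :: 'i \<Rightarrow> complex. (\<lambda>i. (cmod (f i))\<^sup>2) summable_on UNIV}"
  by (rule exI[of _ "\<lambda>_. 0"]) simp

setup_lifting type_definition_ell2

lemma ell2_summable_iff:
  fixes f :: "'i \<Rightarrow> complex"
  shows "(\<lambda>i. (cmod (f i))\<^sup>2) summable_on UNIV \<longleftrightarrow>
    (\<exists>C. \<forall>F. finite F \<longrightarrow> L2_set (\<lambda>i. cmod (f i)) F \<le> C)"
proof
  assume s: "(\<lambda>i. (cmod (f i))\<^sup>2) summable_on UNIV"
  show "\<exists>C. \<forall>F. finite F \<longrightarrow> L2_set (\<lambda>i. cmod (f i)) F \<le> C"
    by (rule exI[of _ "sqrt (\<Sum>\<^sub>\<infinity>i. (cmod (f i))\<^sup>2)"])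
      (auto simp: L2_set_def intro!: finite_sum_le_infsum[OF s])
next
  assume "\<exists>C. \<forall>F. finite F \<longrightarrow> L2_set (\<lambda>i. cmod (f i)) F \<le> C"
  then obtain C where C: "\<And>F. finite F \<Longrightarrow> L2_set (\<lambda>i. cmod (f i)) F \<le> C" by blast
  have "(\<Sum>i\<in>F. (cmod (f i))\<^sup>2) \<le> C\<^sup>2" if "finite F" for F
    using C[OF that] by (simp add: L2_set_def sqrt_le_D)
  then show "(\<lambda>i. (cmod (f i))\<^sup>2) summable_on UNIV"
    by (intro nonneg_bdd_above_summable_on) (auto intro!: bdd_aboveI[of _ "C\<^sup>2"])
qed

lemma ell2_infsum_le_iff:
  fixes f :: "'i \<Rightarrow> complex"
  assumes s: "(\<lambda>i. (cmod (f i))\<^sup>2) summable_on UNIV"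
  shows "sqrt (\<Sum>\<^sub>\<infinity>i. (cmod (f i))\<^sup>2) \<le> C \<longleftrightarrow>
    (\<forall>F. finite F \<longrightarrow> L2_set (\<lambda>i. cmod (f i)) F \<le> C)"
proof
  assume a: "sqrt (\<Sum>\<^sub>\<infinity>i. (cmod (f i))\<^sup>2) \<le> C"
  show "\<forall>F. finite F \<longrightarrow> L2_set (\<lambda>i. cmod (f i)) F \<le> C"
    by (auto simp: L2_set_def intro!: order_trans[OF _ a] finite_sum_le_infsum[OF s])
next
  assume a: "\<forall>F. finite F \<longrightarrow> L2_set (\<lambda>i. cmod (f i)) F \<le> C"
  then have C: "0 \<le> C" by (metis L2_set_empty finite.emptyI)
  have "(\<Sum>i\<in>F. (cmod (f i))\<^sup>2) \<le> C\<^sup>2" if "finite F" for F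
    using a that by (simp add: L2_set_def sqrt_le_D)
  then have "(\<Sum>\<^sub>\<infinity>i. (cmod (f i))\<^sup>2) \<le> C\<^sup>2"
    by (intro infsum_le_finite_sums s) auto
  with C show "sqrt (\<Sum>\<^sub>\<infinity>i. (cmod (f i))\<^sup>2) \<le> C"
    by (simp add: real_le_lsqrt)
qed

lemma L2_set_cmod_triangle:
  "L2_set (\<lambda>i. cmod (f i + g i)) F \<le> L2_set (\<lambda>i. cmod (f i)) F + L2_set (\<lambda>i. cmod (g i)) F"
  by (rule order_trans[OF L2_set_mono L2_set_triangle_ineq]) (auto simp: norm_triangle_ineq)

lemma L2_set_cmod_scale:
  "L2_set (\<lambda>i. cmod (c * f i)) F = cmod c * L2_set (\<lambda>i. cmod (f i)) F"
  by (simp add: norm_mult L2_set_right_distrib)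

instantiation ell2 :: (type) complex_vector
begin
lift_definition zero_ell2 :: "'a ell2" is "\<lambda>_. 0" by simp
lift_definition plus_ell2 :: "'a ell2 \<Rightarrow> 'a ell2 \<Rightarrow> 'a ell2" is "\<lambda>f g i. f i + g i"
proof -
  fix f g :: "'a \<Rightarrow> complex"
  assume "(\<lambda>i. (cmod (f i))\<^sup>2) summable_on UNIV" "(\<lambda>i. (cmod (g i))\<^sup>2) summable_on UNIV"
  then obtain C D where "finite F \<Longrightarrow> L2_set (\<lambda>i. cmod (f i)) F \<le> C"
      "finite F \<Longrightarrow> L2_set (\<lambda>i. cmod (g i)) F \<le> D" for F
    unfolding ell2_summable_iff by blast
  then have "finite F \<Longrightarrow> L2_set (\<lambda>i. cmod (f i + g i)) F \<le> C + D" for F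
    by (rule order_trans[OF L2_set_cmod_triangle add_mono])
  then show "(\<lambda>i. (cmod (f i + g i))\<^sup>2) summable_on UNIV"
    unfolding ell2_summable_iff by blast
qed
lift_definition scaleC_ell2 :: "complex \<Rightarrow> 'a ell2 \<Rightarrow> 'a ell2" is "\<lambda>c f i. c * f i"
  by (simp add: norm_mult power_mult_distrib summable_on_cmult_right)
lift_definition uminus_ell2 :: "'a ell2 \<Rightarrow> 'a ell2" is "\<lambda>f i. - f i" by simp
definition minus_ell2 :: "'a ell2 \<Rightarrow> 'a ell2 \<Rightarrow> 'a ell2" where "minus_ell2 x y = x + - y"
definition scaleR_ell2 :: "real \<Rightarrow> 'a ell2 \<Rightarrow> 'a ell2"
  where "scaleR_ell2 r x = complex_of_real r *\<^sub>C x"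
instance
proof
  fix x y z :: "'a ell2" and a b :: real and c d :: complex
  note [simp] = fun_eq_iff plus_ell2.rep_eq zero_ell2.rep_eq uminus_ell2.rep_eq scaleC_ell2.rep_eq
  note ext = Rep_ell2_inject[THEN iffD1]
  show "x + y + z = x + (y + z)" "x + y = y + x" "0 + x = x" "- x + x = 0"
    by (rule ext, simp)+
  show "x - y = x + - y" by (rule minus_ell2_def)
  show "a *\<^sub>R (x + y) = a *\<^sub>R x + a *\<^sub>R y" "(a + b) *\<^sub>R x = a *\<^sub>R x + b *\<^sub>R x"
    "a *\<^sub>R b *\<^sub>R x = (a * b) *\<^sub>R x" "1 *\<^sub>R x = x"
    unfolding scaleR_ell2_def by (rule ext, simp add: distrib_left distrib_right)+
  show "c *\<^sub>C (x + y) = c *\<^sub>C x + c *\<^sub>C y" "(c + d) *\<^sub>C x = c *\<^sub>C x + d *\<^sub>C x"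
    "c *\<^sub>C d *\<^sub>C x = (c * d) *\<^sub>C x" "1 *\<^sub>C x = x"
    by (rule ext, simp add: distrib_left distrib_right)+
  show "a *\<^sub>R x = complex_of_real a *\<^sub>C x" by (rule scaleR_ell2_def)
qed
end

lemma Rep_ell2_minus: "Rep_ell2 (x - y) i = Rep_ell2 x i - Rep_ell2 y i"
  unfolding minus_ell2_def plus_ell2.rep_eq uminus_ell2.rep_eq by simp

instantiation ell2 :: (type) real_normed_vector
begin
lift_definition norm_ell2 :: "'a ell2 \<Rightarrow> real" is "\<lambda>f. sqrt (\<Sum>\<^sub>\<infinity>i. (cmod (f i))\<^sup>2)" .
definition dist_ell2 :: "'a ell2 \<Rightarrow> 'a ell2 \<Rightarrow> real" where "dist_ell2 x y = norm (x - y)"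
definition sgn_ell2 :: "'a ell2 \<Rightarrow> 'a ell2" where "sgn_ell2 x = x /\<^sub>R norm x"
definition uniformity_ell2 :: "('a ell2 \<times> 'a ell2) filter"
  where "uniformity_ell2 = (INF e\<in>{0<..}. principal {(x, y). dist x y < e})"
definition open_ell2 :: "'a ell2 set \<Rightarrow> bool"
  where "open_ell2 U = (\<forall>x\<in>U. \<forall>\<^sub>F (x', y) in uniformity. x' = x \<longrightarrow> y \<in> U)"

lemma norm_ell2_le_iff: "norm x \<le> C \<longleftrightarrow> (\<forall>F. finite F \<longrightarrow> L2_set (\<lambda>i. cmod (Rep_ell2 x i)) F \<le> C)"
  unfolding norm_ell2.rep_eq by (rule ell2_infsum_le_iff[OF Rep_ell2[unfolded mem_Collect_eq]])

lemma L2_set_le_norm_ell2: "finite F \<Longrightarrow> L2_set (\<lambda>i. cmod (Rep_ell2 x i)) F \<le> norm x"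
  by (rule norm_ell2_le_iff[THEN iffD1, OF order_refl, rule_format])

lemma cmod_le_norm_ell2: "cmod (Rep_ell2 x i) \<le> norm x"
  using member_le_L2_set[of "{i}" i "\<lambda>i. cmod (Rep_ell2 x i)"] L2_set_le_norm_ell2[of "{i}" x]
  by (meson finite.emptyI finite.insertI insertI1 order_trans)

instance
proof
  fix x y :: "'a ell2" and r :: real
  show "norm x = 0 \<longleftrightarrow> x = 0"
  proof
    assume "norm x = 0"
    then have "cmod (Rep_ell2 x i) \<le> 0" for i
      using cmod_le_norm_ell2[of x i] by (simp only:)
    then have "Rep_ell2 x = Rep_ell2 0"
      by (simp add: zero_ell2.rep_eq fun_eq_iff)
    then show "x = 0"
      by (simp only: Rep_ell2_inject)
  next
    assume x: "x = 0"
    show "norm x = 0"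
      unfolding x norm_ell2.rep_eq zero_ell2.rep_eq by simp
  qed
  show "norm (x + y) \<le> norm x + norm y"
    unfolding norm_ell2_le_iff[of "x + y"] plus_ell2.rep_eq
  proof (intro allI impI)
    fix F :: "'a set" assume F: "finite F"
    show "L2_set (\<lambda>i. cmod (Rep_ell2 x i + Rep_ell2 y i)) F \<le> norm x + norm y"
      by (rule order_trans[OF L2_set_cmod_triangle
            add_mono[OF L2_set_le_norm_ell2[OF F] L2_set_le_norm_ell2[OF F]]])
  qed
  show "norm (r *\<^sub>R x) = \<bar>r\<bar> * norm x"
  proof -
    have "norm (r *\<^sub>R x) = sqrt (\<Sum>\<^sub>\<infinity>i. r\<^sup>2 * (cmod (Rep_ell2 x i))\<^sup>2)"
      unfolding scaleR_ell2_def norm_ell2.rep_eq scaleC_ell2.rep_eq norm_mult power_mult_distrib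
      by simp
    also have "\<dots> = \<bar>r\<bar> * norm x"
      unfolding norm_ell2.rep_eq infsum_cmult_right' real_sqrt_mult by simp
    finally show ?thesis .
  qed
  show "dist x y = norm (x - y)" by (rule dist_ell2_def)
  show "sgn x = x /\<^sub>R norm x" by (rule sgn_ell2_def)
  show "uniformity = (INF e\<in>{0<..}. principal {(x :: 'a ell2, y). dist x y < e})"
    by (rule uniformity_ell2_def)
  show "open U = (\<forall>x\<in>U. \<forall>\<^sub>F (x', y) in uniformity. x' = x \<longrightarrow> y \<in> U)" for U :: "'a ell2 set"
    by (rule open_ell2_def)
qed
end

instance ell2 :: (type) banach
proof
  fix X :: "nat \<Rightarrow> 'a ell2"
  assume X: "Cauchy X"
  have "Cauchy (\<lambda>n. Rep_ell2 (X n) i)" for i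
  proof (rule CauchyI)
    fix e :: real assume "0 < e"
    with X obtain M where "\<forall>m\<ge>M. \<forall>n\<ge>M. norm (X m - X n) < e"
      by (meson CauchyD)
    then show "\<exists>M. \<forall>m\<ge>M. \<forall>n\<ge>M. cmod (Rep_ell2 (X m) i - Rep_ell2 (X n) i) < e"
      by (metis Rep_ell2_minus cmod_le_norm_ell2 order_le_less_trans)
  qed
  then have "\<forall>i. \<exists>l. (\<lambda>n. Rep_ell2 (X n) i) \<longlonglongrightarrow> l"
    by (simp add: Cauchy_convergent_iff convergent_def)
  then obtain L where L: "\<And>i. (\<lambda>n. Rep_ell2 (X n) i) \<longlonglongrightarrow> L i" by metis
  obtain B where B: "\<And>n. norm (X n) \<le> B"
    using Cauchy_Bseq[OF X] by (auto simp: Bseq_def)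
  have "L2_set (\<lambda>i. cmod (L i)) F \<le> B" if "finite F" for F
  proof (rule LIMSEQ_le_const2)
    show "(\<lambda>n. L2_set (\<lambda>i. cmod (Rep_ell2 (X n) i)) F) \<longlonglongrightarrow> L2_set (\<lambda>i. cmod (L i)) F"
      unfolding L2_set_def by (intro tendsto_intros L)
    show "\<exists>N. \<forall>n\<ge>N. L2_set (\<lambda>i. cmod (Rep_ell2 (X n) i)) F \<le> B"
      using L2_set_le_norm_ell2[OF that] B order_trans by blast
  qed
  then have "L \<in> {f. (\<lambda>i. (cmod (f i))\<^sup>2) summable_on UNIV}"
    unfolding mem_Collect_eq ell2_summable_iff by blast
  then obtain l where l: "Rep_ell2 l = L"
    by (metis Rep_ell2_cases)
  have "X \<longlonglongrightarrow> l"
  proof (rule LIMSEQ_I)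
    fix e :: real assume "0 < e"
    then obtain M where M: "\<And>m n. m \<ge> M \<Longrightarrow> n \<ge> M \<Longrightarrow> norm (X m - X n) < e / 2"
      using X by (meson CauchyD half_gt_zero)
    have "norm (X m - l) \<le> e / 2" if m: "m \<ge> M" for m
      unfolding norm_ell2_le_iff
    proof (intro allI impI)
      fix F :: "'a set" assume F: "finite F"
      show "L2_set (\<lambda>i. cmod (Rep_ell2 (X m - l) i)) F \<le> e / 2"
      proof (rule LIMSEQ_le_const2)
        show "(\<lambda>n. L2_set (\<lambda>i. cmod (Rep_ell2 (X m - X n) i)) F) \<longlonglongrightarrow>
            L2_set (\<lambda>i. cmod (Rep_ell2 (X m - l) i)) F"
          unfolding L2_set_def Rep_ell2_minus l by (intro tendsto_intros L)
        show "\<exists>N. \<forall>n\<ge>N. L2_set (\<lambda>i. cmod (Rep_ell2 (X m - X n) i)) F \<le> e / 2"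
          using L2_set_le_norm_ell2[OF F] M[OF m] by (meson less_imp_le order_trans)
      qed
    qed
    moreover have "e / 2 < e" using \<open>0 < e\<close> by simp
    ultimately show "\<exists>no. \<forall>n\<ge>no. norm (X n - l) < e"
      using order_le_less_trans by blast
  qed
  then show "convergent X" by (auto simp: convergent_def)
qed

lemma ell2_cinner_summable: "(\<lambda>i. cnj (Rep_ell2 x i) * Rep_ell2 y i) summable_on UNIV"
proof (rule abs_summable_summable, rule nonneg_bdd_above_summable_on)
  have "(\<Sum>i\<in>F. cmod (cnj (Rep_ell2 x i) * Rep_ell2 y i)) \<le> norm x * norm y" if F: "finite F" for F
  proof -
    have "(\<Sum>i\<in>F. cmod (cnj (Rep_ell2 x i) * Rep_ell2 y i)) =
        (\<Sum>i\<in>F. \<bar>cmod (Rep_ell2 x i)\<bar> * \<bar>cmod (Rep_ell2 y i)\<bar>)"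
      by (simp add: norm_mult)
    also have "\<dots> \<le> L2_set (\<lambda>i. cmod (Rep_ell2 x i)) F * L2_set (\<lambda>i. cmod (Rep_ell2 y i)) F"
      by (rule L2_set_mult_ineq)
    also have "\<dots> \<le> norm x * norm y"
      by (intro mult_mono L2_set_le_norm_ell2 F) auto
    finally show ?thesis .
  qed
  then show "bdd_above (sum (\<lambda>i. cmod (cnj (Rep_ell2 x i) * Rep_ell2 y i)) ` {F. F \<subseteq> UNIV \<and> finite F})"
    by (intro bdd_aboveI2[of _ _ "norm x * norm y"]) auto
qed simp

instantiation ell2 :: (type) chilbert_space
begin
definition cinner_ell2 :: "'a ell2 \<Rightarrow> 'a ell2 \<Rightarrow> complex"
  where "cinner_ell2 x y = (\<Sum>\<^sub>\<infinity>i. cnj (Rep_ell2 x i) * Rep_ell2 y i)"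
instance
proof
  fix x y z :: "'a ell2" and c :: complex
  show "cinner x y = cnj (cinner y x)"
    unfolding cinner_ell2_def infsum_cnj[symmetric] by (simp add: mult.commute)
  show "cinner x (y + z) = cinner x y + cinner x z"
    unfolding cinner_ell2_def plus_ell2.rep_eq distrib_left
    by (intro infsum_add ell2_cinner_summable)
  show "cinner x (c *\<^sub>C y) = c * cinner x y"
    unfolding cinner_ell2_def scaleC_ell2.rep_eq
    by (subst infsum_cmult_right'[symmetric]) (simp add: ac_simps)
  have "Re (cinner x x) = (\<Sum>\<^sub>\<infinity>i. Re (cnj (Rep_ell2 x i) * Rep_ell2 x i))"
    unfolding cinner_ell2_def by (rule infsum_Re[symmetric, OF ell2_cinner_summable])
  also have "\<dots> = (\<Sum>\<^sub>\<infinity>i. (cmod (Rep_ell2 x i))\<^sup>2)"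
    by (simp add: cmod_power2 flip: power2_eq_square)
  finally show "norm x = sqrt (Re (cinner x x))"
    by (simp add: norm_ell2.rep_eq)
qed
end



section \<open>Algebraic tensor products\<close>

text \<open>
  The tensor product over the complex numbers is the monoid of formal finite sums of pairs modulo
  the usual relations; additive inverses are given by \<^term>\<open>(- a, b)\<close>.
\<close>

inductive tensor_rel ::
  "('a::complex_vector \<times> 'b::complex_vector) multiset \<Rightarrow> ('a \<times> 'b) multiset \<Rightarrow> bool"
where
  tensor_rel_refl: "tensor_rel X X"
| tensor_rel_sym: "tensor_rel X Y \<Longrightarrow> tensor_rel Y X"
| tensor_rel_trans: "tensor_rel X Y \<Longrightarrow> tensor_rel Y Z \<Longrightarrow> tensor_rel X Z"
| tensor_rel_cong: "tensor_rel X Y \<Longrightarrow> tensor_rel (X + Z) (Y + Z)"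
| tensor_rel_left: "tensor_rel {#(a + a', b)#} {#(a, b), (a', b)#}"
| tensor_rel_right: "tensor_rel {#(a, b + b')#} {#(a, b), (a, b')#}"
| tensor_rel_scale: "tensor_rel {#(c *\<^sub>C a, b)#} {#(a, c *\<^sub>C b)#}"
| tensor_rel_zero: "tensor_rel {#(0, b)#} {#}"

quotient_type (overloaded) ('a, 'b) tensor =
  "('a::complex_vector \<times> 'b::complex_vector) multiset" / tensor_rel
  by (rule equivpI) (auto intro!: reflpI sympI transpI intro: tensor_rel.intros)

lemma tensor_rel_add:
  "tensor_rel X X' \<Longrightarrow> tensor_rel Y Y' \<Longrightarrow> tensor_rel (X + Y) (X' + Y')"
  by (metis add.commute tensor_rel_cong tensor_rel_trans)

lemma tensor_rel_image:
  assumes "tensor_rel X Y"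
    and f: "\<And>a a'. f (a + a') = f a + f a'" and g: "\<And>b b'. g (b + b') = g b + g b'"
    and fg: "\<And>c. \<exists>d. \<forall>a b. f (c *\<^sub>C a) = d *\<^sub>C f a \<and> g (c *\<^sub>C b) = d *\<^sub>C g b"
  shows "tensor_rel (image_mset (map_prod f g) X) (image_mset (map_prod f g) Y)"
  using assms(1)
proof induction
  case (tensor_rel_scale c a b)
  obtain d where "f (c *\<^sub>C a) = d *\<^sub>C f a" "g (c *\<^sub>C b) = d *\<^sub>C g b" using fg by blast
  then show ?case by (simp add: tensor_rel.tensor_rel_scale)
next
  case (tensor_rel_zero b)
  have "f 0 = 0" using f[of 0 0] by simp
  then show ?case by (simp add: tensor_rel.tensor_rel_zero)
qed (auto simp: f g intro: tensor_rel.intros)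

instantiation tensor :: (complex_vector, complex_vector) complex_vector
begin
lift_definition zero_tensor :: "('a, 'b) tensor" is "{#}" .
lift_definition plus_tensor :: "('a, 'b) tensor \<Rightarrow> ('a, 'b) tensor \<Rightarrow> ('a, 'b) tensor" is "(+)"
  by (rule tensor_rel_add)
lift_definition scaleC_tensor :: "complex \<Rightarrow> ('a, 'b) tensor \<Rightarrow> ('a, 'b) tensor"
  is "\<lambda>c. image_mset (map_prod (scaleC c) id)"
proof -
  fix c :: complex and X Y :: "('a \<times> 'b) multiset"
  assume "tensor_rel X Y"
  then show "tensor_rel (image_mset (map_prod (scaleC c) id) X) (image_mset (map_prod (scaleC c) id) Y)"
    by (rule tensor_rel_image)
      (auto simp: scaleC_add_right scaleC_scaleC mult.commute)
qed
definition uminus_tensor :: "('a, 'b) tensor \<Rightarrow> ('a, 'b) tensor" where "uminus_tensor t = (- 1) *\<^sub>C t"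
definition minus_tensor :: "('a, 'b) tensor \<Rightarrow> ('a, 'b) tensor \<Rightarrow> ('a, 'b) tensor"
  where "minus_tensor s t = s + - t"
definition scaleR_tensor :: "real \<Rightarrow> ('a, 'b) tensor \<Rightarrow> ('a, 'b) tensor"
  where "scaleR_tensor r t = complex_of_real r *\<^sub>C t"

lemma tensor_rel_scale_plus:
  "tensor_rel (image_mset (map_prod (scaleC (c + d)) id) X)
    (image_mset (map_prod (scaleC c) id) X + image_mset (map_prod (scaleC d) id) X)"
proof (induction X)
  case (add x X)
  have "tensor_rel {#map_prod (scaleC (c + d)) id x#}
      ({#map_prod (scaleC c) id x#} + {#map_prod (scaleC d) id x#})"
    using tensor_rel_left[of "c *\<^sub>C fst x" "d *\<^sub>C fst x" "snd x"]
    by (cases x) (simp add: scaleC_add_left add_mset_commute)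
  from tensor_rel_add[OF this add.IH] show ?case
    by (simp add: add_mset_commute id_def)
qed (simp add: tensor_rel_refl)

lemma tensor_rel_scale_zero: "tensor_rel (image_mset (map_prod (scaleC 0) id) X) {#}"
proof (induction X)
  case (add x X)
  have "tensor_rel {#map_prod (scaleC 0) id x#} {#}"
    by (cases x) (simp add: tensor_rel_zero)
  from tensor_rel_add[OF this add.IH] show ?case
    by (simp only: image_mset_add_mset union_mset_add_mset_left add_0)
qed (simp add: tensor_rel_refl)

instance
proof
  fix x y z :: "('a, 'b) tensor" and a b :: real and c d :: complex
  show add_assoc: "x + y + z = x + (y + z)" by transfer (simp add: ac_simps tensor_rel_refl)
  show add_commute: "x + y = y + x" by transfer (simp add: ac_simps tensor_rel_refl)
  show "0 + x = x" by transfer (simp add: tensor_rel_refl)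
  have zero: "0 *\<^sub>C x = 0" by transfer (rule tensor_rel_scale_zero)
  have one: "1 *\<^sub>C x = x" for x :: "('a, 'b) tensor"
    by transfer (simp add: id_def map_prod_def tensor_rel_refl)
  have add_left: "(c + d) *\<^sub>C x = c *\<^sub>C x + d *\<^sub>C x" for c d and x :: "('a, 'b) tensor"
    by transfer (rule tensor_rel_scale_plus)
  have add_right: "c *\<^sub>C (x + y) = c *\<^sub>C x + c *\<^sub>C y" for c and x y :: "('a, 'b) tensor"
    by transfer (simp add: tensor_rel_refl)
  have scale: "c *\<^sub>C d *\<^sub>C x = (c * d) *\<^sub>C x" for c d and x :: "('a, 'b) tensor"
    by transfer (simp add: tensor_rel_refl multiset.map_comp prod.map_comp comp_def
        scaleC_scaleC id_def)
  show "- x + x = 0"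
    using add_left[of "-1" 1 x] zero by (simp only: uminus_tensor_def one) simp
  show "x - y = x + - y" by (rule minus_tensor_def)
  show "c *\<^sub>C (x + y) = c *\<^sub>C x + c *\<^sub>C y" "a *\<^sub>R (x + y) = a *\<^sub>R x + a *\<^sub>R y"
    by (simp_all only: scaleR_tensor_def add_right)
  show "(c + d) *\<^sub>C x = c *\<^sub>C x + d *\<^sub>C x" "(a + b) *\<^sub>R x = a *\<^sub>R x + b *\<^sub>R x"
    by (simp_all only: scaleR_tensor_def add_left of_real_add)
  show "c *\<^sub>C d *\<^sub>C x = (c * d) *\<^sub>C x" "a *\<^sub>R b *\<^sub>R x = (a * b) *\<^sub>R x"
    by (simp_all only: scaleR_tensor_def scale of_real_mult)
  show "1 *\<^sub>C x = x" "1 *\<^sub>R x = x"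
    by (simp_all only: scaleR_tensor_def one of_real_1)
  show "a *\<^sub>R x = complex_of_real a *\<^sub>C x" by (rule scaleR_tensor_def)
qed
end

lift_definition tens :: "'a::complex_vector \<Rightarrow> 'b::complex_vector \<Rightarrow> ('a, 'b) tensor"  (infixr "\<otimes>" 72)
  is "\<lambda>a b. {#(a, b)#}" .

text \<open>
  The map induced on the tensor product by \<^term>\<open>f\<close>. It evaluates \<^term>\<open>f\<close> on an arbitrary
  representative and is only meaningful for balanced \<^term>\<open>f\<close>, see \<open>tensor_lift_tens\<close>.
\<close>

definition tensor_lift ::
  "('a::complex_vector \<Rightarrow> 'b::complex_vector \<Rightarrow> 'v::comm_monoid_add) \<Rightarrow> ('a, 'b) tensor \<Rightarrow> 'v"
  where "tensor_lift f t = (\<Sum>(a, b)\<in>#rep_tensor t. f a b)"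

definition balanced ::
  "('a::complex_vector \<Rightarrow> 'b::complex_vector \<Rightarrow> 'v::ab_group_add) \<Rightarrow> bool"
  where "balanced f \<longleftrightarrow>
    (\<forall>a a' b. f (a + a') b = f a b + f a' b) \<and>
    (\<forall>a b b'. f a (b + b') = f a b + f a b') \<and>
    (\<forall>c a b. f (c *\<^sub>C a) b = f a (c *\<^sub>C b))"

lemma tensor_rel_sum:
  assumes "tensor_rel X Y" "balanced f"
  shows "(\<Sum>(a, b)\<in>#X. f a b) = (\<Sum>(a, b)\<in>#Y. f a b)"
  using assms(1)
proof induction
  case (tensor_rel_zero b)
  have "f (0 + 0) b = f 0 b + f 0 b" using assms(2) unfolding balanced_def by blast
  then show ?case by simp
qed (use assms(2) in \<open>auto simp: balanced_def\<close>)

lemma tensor_lift_abs: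
  assumes "balanced f"
  shows "tensor_lift f (abs_tensor X) = (\<Sum>(a, b)\<in>#X. f a b)"
  unfolding tensor_lift_def
  by (rule tensor_rel_sum[OF _ assms])
    (metis Quotient3_tensor Quotient3_def rep_abs_rsp_left tensor_rel_refl)

lemma tensor_lift_tens: "balanced f \<Longrightarrow> tensor_lift f (a \<otimes> b) = f a b"
  by (simp add: tens.abs_eq tensor_lift_abs)

lemma tensor_lift_add:
  assumes "balanced f"
  shows "tensor_lift f (s + t) = tensor_lift f s + tensor_lift f t"
  by (induct s, induct t) (simp add: plus_tensor.abs_eq tensor_lift_abs[OF assms])

definition tensor_map ::
  "('a \<Rightarrow> 'c) \<Rightarrow> ('b \<Rightarrow> 'd) \<Rightarrow> ('a::complex_vector, 'b::complex_vector) tensor \<Rightarrow>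
    ('c::complex_vector, 'd::complex_vector) tensor"
  where "tensor_map f g = tensor_lift (\<lambda>a b. f a \<otimes> g b)"

definition tensor_assoc ::
  "(('a::complex_vector, 'b::complex_vector) tensor, 'c::complex_vector) tensor \<Rightarrow>
    ('a, ('b, 'c) tensor) tensor"
  where "tensor_assoc = tensor_lift (\<lambda>t c. tensor_lift (\<lambda>a b. a \<otimes> (b \<otimes> c)) t)"


section \<open>Unital *-algebras\<close>

class complex_star_algebra = complex_vector + ring + monoid_mult +
  fixes star :: "'a \<Rightarrow> 'a"
  assumes mult_scaleC_left: "(c *\<^sub>C a) * b = c *\<^sub>C (a * b)"
    and mult_scaleC_right: "a * (c *\<^sub>C b) = c *\<^sub>C (a * b)"
    and star_add: "star (a + b) = star a + star b"
    and star_scaleC: "star (c *\<^sub>C a) = cnj c *\<^sub>C star a"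
    and star_mult: "star (a * b) = star b * star a"
    and star_star: "star (star a) = a"

lemma star_one [simp]: "star (1 :: 'a::complex_star_algebra) = 1"
  by (metis mult_1 mult_1_right star_mult star_star)

definition tensor_mult_rep ::
  "('a::complex_star_algebra \<times> 'b::complex_star_algebra) multiset \<Rightarrow> ('a \<times> 'b) multiset \<Rightarrow> ('a \<times> 'b) multiset"
  where "tensor_mult_rep X Y = (\<Sum>p\<in>#X. \<Sum>q\<in>#Y. {#(fst p * fst q, snd p * snd q)#})"

lemma sum_mset_singleton: "(\<Sum>x\<in>#X. {#f x#}) = image_mset f X"
  by (induction X) auto

lemma tensor_mult_rep_left:
  "tensor_mult_rep X Y = (\<Sum>p\<in>#X. image_mset (map_prod ((*) (fst p)) ((*) (snd p))) Y)"
  by (simp add: tensor_mult_rep_def sum_mset_singleton map_prod_def case_prod_unfold)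

lemma tensor_mult_rep_right:
  "tensor_mult_rep X Y = (\<Sum>q\<in>#Y. image_mset (map_prod (\<lambda>a. a * fst q) (\<lambda>b. b * snd q)) X)"
  unfolding tensor_mult_rep_def
  by (subst sum_mset.swap) (simp add: sum_mset_singleton map_prod_def case_prod_unfold)

lemma tensor_rel_sum_mset:
  "(\<And>x. tensor_rel (f x) (g x)) \<Longrightarrow> tensor_rel (\<Sum>x\<in>#X. f x) (\<Sum>x\<in>#X. g x)"
  by (induction X) (auto intro: tensor_rel_refl tensor_rel_add)

lemma tensor_rel_mult:
  assumes "tensor_rel X X'" "tensor_rel Y Y'"
  shows "tensor_rel (tensor_mult_rep X Y) (tensor_mult_rep X' Y')"
proof (rule tensor_rel_trans)
  show "tensor_rel (tensor_mult_rep X Y) (tensor_mult_rep X' Y)"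
    unfolding tensor_mult_rep_right
    by (intro tensor_rel_sum_mset tensor_rel_image[OF assms(1)])
      (auto simp: distrib_right mult_scaleC_left)
  show "tensor_rel (tensor_mult_rep X' Y) (tensor_mult_rep X' Y')"
    unfolding tensor_mult_rep_left
    by (intro tensor_rel_sum_mset tensor_rel_image[OF assms(2)])
      (auto simp: distrib_left mult_scaleC_right)
qed

instantiation tensor :: (complex_star_algebra, complex_star_algebra) complex_star_algebra
begin

lift_definition one_tensor :: "('a, 'b) tensor" is "{#(1, 1)#}" .
lift_definition times_tensor :: "('a, 'b) tensor \<Rightarrow> ('a, 'b) tensor \<Rightarrow> ('a, 'b) tensor"
  is tensor_mult_rep by (rule tensor_rel_mult)
lift_definition star_tensor :: "('a, 'b) tensor \<Rightarrow> ('a, 'b) tensor"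
  is "image_mset (map_prod star star)"
proof -
  fix X Y :: "('a \<times> 'b) multiset"
  assume "tensor_rel X Y"
  then show "tensor_rel (image_mset (map_prod star star) X) (image_mset (map_prod star star) Y)"
    by (rule tensor_rel_image) (auto simp: star_add star_scaleC)
qed

lemma tensor_mult_rep_simps:
  "tensor_mult_rep {#} Y = {#}" "tensor_mult_rep X {#} = {#}"
  "tensor_mult_rep (X + X') Y = tensor_mult_rep X Y + tensor_mult_rep X' Y"
  "tensor_mult_rep X (Y + Y') = tensor_mult_rep X Y + tensor_mult_rep X Y'"
  "tensor_mult_rep {#p#} {#q#} = {#(fst p * fst q, snd p * snd q)#}"
  by (simp_all add: tensor_mult_rep_def sum_mset.distrib)

lemma mset_induct_plus:
  assumes "P {#}" "\<And>x. P {#x#}" "\<And>X Y. P X \<Longrightarrow> P Y \<Longrightarrow> P (X + Y)"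
  shows "P X"
proof (induction X)
  case (add x X)
  then have "P ({#x#} + X)" by (intro assms(2,3))
  then show ?case by simp
qed (rule assms(1))

lemma tensor_mult_rep_assoc:
  "tensor_mult_rep (tensor_mult_rep X Y) Z = tensor_mult_rep X (tensor_mult_rep Y Z)"
proof (induction X rule: mset_induct_plus)
  case (2 x)
  show ?case
  proof (induction Y rule: mset_induct_plus)
    case (2 y)
    show ?case
      by (induction Z rule: mset_induct_plus) (simp_all add: tensor_mult_rep_simps mult.assoc)
  qed (simp_all add: tensor_mult_rep_simps)
qed (simp_all add: tensor_mult_rep_simps)

lemma tensor_mult_rep_star:
  "image_mset (map_prod star star) (tensor_mult_rep X Y) =
    tensor_mult_rep (image_mset (map_prod star star) Y) (image_mset (map_prod star star) X)"
proof (induction X rule: mset_induct_plus)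
  case (2 x)
  show ?case
    by (induction Y rule: mset_induct_plus) (simp_all add: tensor_mult_rep_simps star_mult)
qed (simp_all add: tensor_mult_rep_simps)

lemma tensor_mult_rep_scale_left:
  "tensor_mult_rep (image_mset (map_prod (scaleC c) id) X) Y =
    image_mset (map_prod (scaleC c) id) (tensor_mult_rep X Y)"
proof (induction X rule: mset_induct_plus)
  case (2 x)
  show ?case
    by (induction Y rule: mset_induct_plus) (simp_all add: tensor_mult_rep_simps mult_scaleC_left)
qed (simp_all add: tensor_mult_rep_simps)

lemma tensor_mult_rep_scale_right:
  "tensor_mult_rep X (image_mset (map_prod (scaleC c) id) Y) =
    image_mset (map_prod (scaleC c) id) (tensor_mult_rep X Y)"
proof (induction X rule: mset_induct_plus)
  case (2 x)
  show ?case
    by (induction Y rule: mset_induct_plus) (simp_all add: tensor_mult_rep_simps mult_scaleC_right)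
qed (simp_all add: tensor_mult_rep_simps)

lemma tensor_mult_rep_one:
  "tensor_mult_rep {#(1, 1)#} X = X" "tensor_mult_rep X {#(1, 1)#} = X"
  by (induction X rule: mset_induct_plus) (simp_all add: tensor_mult_rep_simps)

lemma tensor_rel_star_scale:
  "tensor_rel (image_mset (map_prod star star) (image_mset (map_prod (scaleC c) id) X))
    (image_mset (map_prod (scaleC (cnj c)) id) (image_mset (map_prod star star) X))"
  by (simp add: multiset.map_comp prod.map_comp comp_def star_scaleC tensor_rel_refl)

instance
proof
  fix x y z :: "('a, 'b) tensor" and c :: complex
  show "x * y * z = x * (y * z)"
    by transfer (simp add: tensor_mult_rep_assoc tensor_rel_refl)
  show "(x + y) * z = x * z + y * z" "x * (y + z) = x * y + x * z"
    by (transfer, simp add: tensor_mult_rep_simps tensor_rel_refl)+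
  show "1 * x = x" "x * 1 = x"
    by (transfer, simp add: tensor_mult_rep_one tensor_rel_refl)+
  show "(c *\<^sub>C x) * y = c *\<^sub>C (x * y)"
    by transfer (simp add: tensor_mult_rep_scale_left tensor_rel_refl)
  show "x * (c *\<^sub>C y) = c *\<^sub>C (x * y)"
    by transfer (simp add: tensor_mult_rep_scale_right tensor_rel_refl)
  show "star (x + y) = star x + star y"
    by transfer (simp add: tensor_rel_refl)
  show "star (c *\<^sub>C x) = cnj c *\<^sub>C star x"
    by transfer (rule tensor_rel_star_scale)
  show "star (x * y) = star y * star x"
    by transfer (simp add: tensor_mult_rep_star tensor_rel_refl)
  show "star (star x) = x"
    by transfer (simp add: multiset.map_comp prod.map_comp comp_def star_star tensor_rel_refl
        map_prod_def case_prod_unfold)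
qed
end

lemma tens_mult: "(a \<otimes> b) * (c \<otimes> d) = (a * c) \<otimes> (b * d)"
  by transfer (simp add: tensor_mult_rep_simps tensor_rel_refl)

lemma star_tens: "star (a \<otimes> b) = star a \<otimes> star b"
  by transfer (simp add: tensor_rel_refl)


section \<open>Compact quantum groups\<close>

locale hopf_star_algebra =
  fixes \<Delta> :: "'a::complex_star_algebra \<Rightarrow> ('a, 'a) tensor"
    and \<epsilon> :: "'a \<Rightarrow> complex"
    and S :: "'a \<Rightarrow> 'a"
  assumes comult_clinear: "clinear \<Delta>"
    and comult_mult: "\<Delta> (a * b) = \<Delta> a * \<Delta> b"
    and comult_one: "\<Delta> 1 = 1"
    and comult_star: "\<Delta> (star a) = star (\<Delta> a)"
    and counit_clinear: "clinear \<epsilon>"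
    and counit_mult: "\<epsilon> (a * b) = \<epsilon> a * \<epsilon> b"
    and counit_one: "\<epsilon> 1 = 1"
    and counit_star: "\<epsilon> (star a) = cnj (\<epsilon> a)"
    and coassoc: "tensor_assoc (tensor_map \<Delta> id (\<Delta> a)) = tensor_map id \<Delta> (\<Delta> a)"
    and counit_left: "tensor_lift (\<lambda>x y. \<epsilon> x *\<^sub>C y) (\<Delta> a) = a"
    and counit_right: "tensor_lift (\<lambda>x y. \<epsilon> y *\<^sub>C x) (\<Delta> a) = a"
    and antipode_clinear: "clinear S"
    and antipode_left: "tensor_lift (\<lambda>x y. S x * y) (\<Delta> a) = \<epsilon> a *\<^sub>C 1"
    and antipode_right: "tensor_lift (\<lambda>x y. x * S y) (\<Delta> a) = \<epsilon> a *\<^sub>C 1"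

text \<open>
  A finite-dimensional unitary corepresentation, as a matrix \<^term>\<open>u\<close> with rows and columns
  indexed by \<^term>\<open>{..<n}\<close>.
\<close>

definition unitary_corep ::
  "('a::complex_star_algebra \<Rightarrow> ('a, 'a) tensor) \<Rightarrow> ('a \<Rightarrow> complex) \<Rightarrow> nat \<Rightarrow> (nat \<Rightarrow> nat \<Rightarrow> 'a) \<Rightarrow> bool"
  where "unitary_corep \<Delta> \<epsilon> n u \<longleftrightarrow>
    (\<forall>i<n. \<forall>j<n.
      \<Delta> (u i j) = (\<Sum>k<n. u i k \<otimes> u k j) \<and>
      \<epsilon> (u i j) = (if i = j then 1 else 0) \<and>
      (\<Sum>k<n. star (u k i) * u k j) = (if i = j then 1 else 0) \<and>
      (\<Sum>k<n. u i k * star (u j k)) = (if i = j then 1 else 0))"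

text \<open>
  The Hopf *-algebras \<open>Pol(G)\<close> of compact quantum groups \<open>G\<close>. Over a compact quantum group every
  finite-dimensional corepresentation is equivalent to a unitary one, so restricting to the
  unitary ones does not change the span of matrix elements.
\<close>

locale compact_quantum_group = hopf_star_algebra +
  assumes span_matrix_elements:
    "cvec.span {u i j | n u i j. unitary_corep \<Delta> \<epsilon> n u \<and> i < n \<and> j < n} = UNIV"


section \<open>C*-norms and completions\<close>

definition cstar_norm :: "('a::complex_star_algebra \<Rightarrow> real) \<Rightarrow> bool"
  where "cstar_norm N \<longleftrightarrow>
    (\<forall>a. 0 \<le> N a) \<and> (\<forall>a. N a = 0 \<longleftrightarrow> a = 0) \<and>
    (\<forall>a b. N (a + b) \<le> N a + N b) \<and> (\<forall>c a. N (c *\<^sub>C a) = cmod c * N a) \<and>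
    (\<forall>a b. N (a * b) \<le> N a * N b) \<and> (\<forall>a. N (star a * a) = (N a)\<^sup>2)"

text \<open>
  The completion with respect to a seminorm \<^term>\<open>N\<close>: Cauchy sequences modulo null sequences,
  with operations induced by the pointwise ones.
\<close>

definition cauchy_seqs :: "('a::ab_group_add \<Rightarrow> real) \<Rightarrow> (nat \<Rightarrow> 'a) set"
  where "cauchy_seqs N = {x. \<forall>e>0. \<exists>M. \<forall>m\<ge>M. \<forall>n\<ge>M. N (x m - x n) < e}"

definition null_rel :: "('a::ab_group_add \<Rightarrow> real) \<Rightarrow> ((nat \<Rightarrow> 'a) \<times> (nat \<Rightarrow> 'a)) set"
  where "null_rel N =
    {(x, y). x \<in> cauchy_seqs N \<and> y \<in> cauchy_seqs N \<and> (\<lambda>n. N (x n - y n)) \<longlonglongrightarrow> 0}"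

definition completion :: "('a::ab_group_add \<Rightarrow> real) \<Rightarrow> (nat \<Rightarrow> 'a) set set"
  where "completion N = cauchy_seqs N // null_rel N"

definition to_completion :: "('a::ab_group_add \<Rightarrow> real) \<Rightarrow> 'a \<Rightarrow> (nat \<Rightarrow> 'a) set"
  where "to_completion N a = null_rel N `` {\<lambda>_. a}"

definition completion_add ::
  "('a::ab_group_add \<Rightarrow> real) \<Rightarrow> (nat \<Rightarrow> 'a) set \<Rightarrow> (nat \<Rightarrow> 'a) set \<Rightarrow> (nat \<Rightarrow> 'a) set"
  where "completion_add N X Y = (\<Union>x\<in>X. \<Union>y\<in>Y. null_rel N `` {\<lambda>n. x n + y n})"

definition completion_mult ::
  "('a::complex_star_algebra \<Rightarrow> real) \<Rightarrow> (nat \<Rightarrow> 'a) set \<Rightarrow> (nat \<Rightarrow> 'a) set \<Rightarrow> (nat \<Rightarrow> 'a) set"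
  where "completion_mult N X Y = (\<Union>x\<in>X. \<Union>y\<in>Y. null_rel N `` {\<lambda>n. x n * y n})"

definition completion_scale ::
  "('a::complex_vector \<Rightarrow> real) \<Rightarrow> complex \<Rightarrow> (nat \<Rightarrow> 'a) set \<Rightarrow> (nat \<Rightarrow> 'a) set"
  where "completion_scale N c X = (\<Union>x\<in>X. null_rel N `` {\<lambda>n. c *\<^sub>C x n})"

definition completion_star ::
  "('a::complex_star_algebra \<Rightarrow> real) \<Rightarrow> (nat \<Rightarrow> 'a) set \<Rightarrow> (nat \<Rightarrow> 'a) set"
  where "completion_star N X = (\<Union>x\<in>X. null_rel N `` {\<lambda>n. star (x n)})"

definition completion_star_hom ::
  "('a::complex_star_algebra \<Rightarrow> real) \<Rightarrow> ('b::complex_star_algebra \<Rightarrow> real) \<Rightarrow>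
    ((nat \<Rightarrow> 'a) set \<Rightarrow> (nat \<Rightarrow> 'b) set) \<Rightarrow> bool"
  where "completion_star_hom N M \<Phi> \<longleftrightarrow>
    \<Phi> ` completion N \<subseteq> completion M \<and>
    (\<forall>X\<in>completion N. \<forall>Y\<in>completion N.
      \<Phi> (completion_add N X Y) = completion_add M (\<Phi> X) (\<Phi> Y) \<and>
      \<Phi> (completion_mult N X Y) = completion_mult M (\<Phi> X) (\<Phi> Y)) \<and>
    (\<forall>X\<in>completion N.
      (\<forall>c. \<Phi> (completion_scale N c X) = completion_scale M c (\<Phi> X)) \<and>
      \<Phi> (completion_star N X) = completion_star M (\<Phi> X))"


section \<open>Representations and the spatial tensor norm\<close>

text \<open>Representations are not required to be nondegenerate.\<close>

definition star_rep :: "('a::complex_star_algebra \<Rightarrow> ('h::chilbert_space \<Rightarrow>\<^sub>L 'h)) \<Rightarrow> bool"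
  where "star_rep \<pi> \<longleftrightarrow>
    (\<forall>a. clinear (blinfun_apply (\<pi> a))) \<and>
    (\<forall>a b. \<pi> (a + b) = \<pi> a + \<pi> b) \<and>
    (\<forall>c a x. blinfun_apply (\<pi> (c *\<^sub>C a)) x = c *\<^sub>C blinfun_apply (\<pi> a) x) \<and>
    (\<forall>a b. \<pi> (a * b) = \<pi> a o\<^sub>L \<pi> b) \<and>
    (\<forall>a x y. cinner (blinfun_apply (\<pi> (star a)) x) y = cinner x (blinfun_apply (\<pi> a) y))"

text \<open>
  The Hilbert space tensor
  product is the completion of the algebraic one, so the norm of a bounded operator on it is its norm
  on the algebraic tensor product.
\<close>

definition tensor_cinner ::
  "('h::chilbert_space, 'k::chilbert_space) tensor \<Rightarrow> ('h, 'k) tensor \<Rightarrow> complex"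
  where "tensor_cinner u v =
    tensor_lift (\<lambda>x y. tensor_lift (\<lambda>x' y'. cinner x x' * cinner y y') v) u"

lemma cinner_add_left: "cinner (x + y) z = cinner x z + cinner y z"
  using cinner_commute[of _ z] by (metis cinner_add_right complex_cnj_add)

lemma cinner_scaleC_left: "cinner (c *\<^sub>C x) y = cnj c * cinner x y"
  using cinner_commute[of _ y] by (metis cinner_scaleC_right complex_cnj_mult)

lemma tensor_cinner_tens: "tensor_cinner (x \<otimes> y) (x' \<otimes> y') = cinner x x' * cinner y y'"
proof -
  have in_right: "balanced (\<lambda>x' y'. cinner x x' * cinner y y')" for x :: 'a and y :: 'b
    by (simp add: balanced_def cinner_add_right cinner_scaleC_right algebra_simps)
  have in_left: "balanced (\<lambda>x y. tensor_lift (\<lambda>x' y'. cinner x x' * cinner y y') v)"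
    for v :: "('a, 'b) tensor"
    unfolding balanced_def tensor_lift_def
    by (simp add: case_prod_unfold cinner_add_left cinner_scaleC_left distrib_left distrib_right
        sum_mset.distrib mult_ac)
  show ?thesis
    unfolding tensor_cinner_def
    by (rule trans[OF tensor_lift_tens[OF in_left] tensor_lift_tens[OF in_right]])
qed

definition tensor_norm :: "('h::chilbert_space, 'k::chilbert_space) tensor \<Rightarrow> real"
  where "tensor_norm u = sqrt (Re (tensor_cinner u u))"

definition tensor_opnorm ::
  "(('h::chilbert_space, 'k::chilbert_space) tensor \<Rightarrow> ('h, 'k) tensor) \<Rightarrow> real"
  where "tensor_opnorm T = Sup {tensor_norm (T u) | u. tensor_norm u \<le> 1}"

definition tensor_rep ::
  "('a::complex_vector \<Rightarrow> ('h::chilbert_space \<Rightarrow>\<^sub>L 'h)) \<Rightarrow>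
    ('b::complex_vector \<Rightarrow> ('k::chilbert_space \<Rightarrow>\<^sub>L 'k)) \<Rightarrow>
    ('a, 'b) tensor \<Rightarrow> ('h, 'k) tensor \<Rightarrow> ('h, 'k) tensor"
  where "tensor_rep \<rho> \<sigma> t u =
    tensor_lift (\<lambda>a b. tensor_map (blinfun_apply (\<rho> a)) (blinfun_apply (\<sigma> b)) u) t"

text \<open>
  The norm on the algebraic tensor product of \<^typ>\<open>'a\<close> and \<^typ>\<open>'b\<close> inherited from the spatial
  tensor product of their completions with respect to \<^term>\<open>N\<close> and \<^term>\<open>M\<close>, as the supremum of
  \<open>\<parallel>(\<rho> \<otimes> \<sigma>)(t)\<parallel>\<close> over all representations of the two completions; these are the contractive
  representations of the dense subalgebras \<^typ>\<open>'a\<close> and \<^typ>\<open>'b\<close>. Representations on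
  \<^typ>\<open>'a ell2\<close> and \<^typ>\<open>'b ell2\<close> suffice: up to an arbitrarily small error, \<open>\<parallel>(\<rho> \<otimes> \<sigma>)(t)\<parallel>\<close> is
  attained on subrepresentations with finitely many generators; the essential part of such a
  representation of \<^typ>\<open>'a\<close> has a dense subspace that is a quotient of some \<open>'a\<^sup>n\<close>, hence Hilbert
  dimension at most the cardinality of \<^typ>\<open>'a\<close>, and it extends by zero to \<^typ>\<open>'a ell2\<close>.
\<close>

definition spatial_norm ::
  "('a::complex_star_algebra \<Rightarrow> real) \<Rightarrow> ('b::complex_star_algebra \<Rightarrow> real) \<Rightarrow> ('a, 'b) tensor \<Rightarrow> real"
  where "spatial_norm N M t = Sup {tensor_opnorm (tensor_rep \<rho> \<sigma> t) | \<rho> \<sigma>.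
    star_rep (\<rho> :: 'a \<Rightarrow> ('a ell2 \<Rightarrow>\<^sub>L 'a ell2)) \<and> (\<forall>a. norm (\<rho> a) \<le> N a) \<and>
    star_rep (\<sigma> :: 'b \<Rightarrow> ('b ell2 \<Rightarrow>\<^sub>L 'b ell2)) \<and> (\<forall>b. norm (\<sigma> b) \<le> M b)}"

text \<open>
  The spatial tensor product of the completion of \<^typ>\<open>'a\<close> with itself is the completion of the
  algebraic tensor product of \<^typ>\<open>'a\<close> with itself in the spatial norm.
\<close>

definition quantum_group_norm ::
  "('a::complex_star_algebra \<Rightarrow> ('a, 'a) tensor) \<Rightarrow> ('a \<Rightarrow> real) \<Rightarrow> bool"
  where "quantum_group_norm \<Delta> N \<longleftrightarrow> cstar_norm N \<and>
    (\<exists>\<Phi>. completion_star_hom N (spatial_norm N N) \<Phi> \<and>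
      (\<forall>a. \<Phi> (to_completion N a) = to_completion (spatial_norm N N) (\<Delta> a)))"

text \<open>The direct sum of a representation and a character, acting on \<open>H \<oplus> \<complex>\<close>.\<close>

definition sum_character ::
  "('a \<Rightarrow> ('h::chilbert_space \<Rightarrow>\<^sub>L 'h)) \<Rightarrow> ('a \<Rightarrow> complex) \<Rightarrow> 'a \<Rightarrow> (('h \<times> complex) \<Rightarrow>\<^sub>L ('h \<times> complex))"
  where "sum_character \<pi> \<epsilon> a = Blinfun (\<lambda>(x, z). (blinfun_apply (\<pi> a) x, \<epsilon> a * z))"

lemma sum_character_apply:
  "blinfun_apply (sum_character \<pi> \<epsilon> a) (x, z) = (blinfun_apply (\<pi> a) x, \<epsilon> a * z)"
proof -
  have "bounded_linear (\<lambda>p :: 'a \<times> complex. (blinfun_apply (\<pi> a) (fst p), \<epsilon> a * snd p))"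
    by (intro bounded_linear_Pair bounded_linear_compose[OF blinfun.bounded_linear_right]
        bounded_linear_compose[OF bounded_linear_mult_right] bounded_linear_fst bounded_linear_snd)
  then show ?thesis
    by (simp add: sum_character_def bounded_linear_Blinfun_apply case_prod_unfold)
qed

end

theory Submission
  imports Defs
begin

text \<open>
  Write \<open>N' = max N |\<epsilon>|\<close>. That \<open>N'\<close> is the norm of \<open>\<pi> \<oplus> \<epsilon>\<close> and a C*-norm is immediate; the content is
  that \<open>\<Delta>\<close> extends to the completions. For this it is enough to bound \<open>(\<rho> \<otimes> \<sigma>)(\<Delta> a)\<close> by a fixed multiple
  of \<open>N' a\<close>, for all representations \<open>\<rho>\<close> and \<open>\<sigma>\<close> that are contractive for \<open>N'\<close>
  (\<open>completion_star_hom_extension\<close>).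

  For \<open>\<rho> = \<sigma> = \<pi> \<oplus> \<epsilon>\<close> the reason is that \<open>\<rho> \<otimes> \<sigma>\<close> decomposes into \<open>\<pi> \<otimes> \<pi>\<close>, \<open>\<pi> \<otimes> \<epsilon>\<close>, \<open>\<epsilon> \<otimes> \<pi>\<close> and
  \<open>\<epsilon> \<otimes> \<epsilon>\<close>. At \<open>\<Delta> a\<close> the first is controlled by the hypothesis on \<open>N\<close>, and by the counit identities the
  others are \<open>\<pi> a\<close>, \<open>\<pi> a\<close> and \<open>\<epsilon> a\<close>. The spatial norm is a supremum over all contractive
  representations, so the same decomposition is needed for an arbitrary one. If \<open>|\<epsilon>| \<le> N\<close> then \<open>N' = N\<close>.
  Otherwise there is \<open>p\<close> with \<open>\<epsilon> p = 1\<close> and \<open>N p < 1\<close>, and the powers of \<open>p\<close> converge to a central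
  projection that cuts every representation into a multiple of \<open>\<epsilon>\<close> and a part contractive for \<open>N\<close>
  (\<open>split_off_character\<close>).

  The hypothesis on \<open>N\<close> provides a *-homomorphism of completions with no bound on it, so its automatic
  contractivity has to be proved (\<open>quantum_group_norm_comult_bound\<close>). The argument uses selfadjoint
  square roots of \<open>1 - h\<close> for selfadjoint \<open>h\<close> of norm less than \<open>1\<close> (\<open>cauchy_sqrt\<close>).

  The estimates on Hilbert space tensor products rest on the inequality
  \<open>\<parallel>(A \<otimes> B) u\<parallel> \<le> \<parallel>A\<parallel> \<parallel>B\<parallel> \<parallel>u\<parallel>\<close> (\<open>tensor_norm_map\<close>), which comes from expanding \<open>u\<close> along orthogonal
  vectors in one factor.
\<close>

section \<open>Linear maps on algebraic tensor products\<close>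

lemma clinear_iff:
  "clinear f \<longleftrightarrow> (\<forall>x y. f (x + y) = f x + f y) \<and> (\<forall>c x. f (c *\<^sub>C x) = c *\<^sub>C f x)"
  by (simp add: Vector_Spaces.linear_iff cvec.vector_space_axioms)

lemma clinear_add: "clinear f \<Longrightarrow> f (x + y) = f x + f y"
  and clinear_scale: "clinear f \<Longrightarrow> f (c *\<^sub>C x) = c *\<^sub>C f x"
  by (auto simp: clinear_iff)

lemma clinear_zero: "clinear f \<Longrightarrow> f 0 = 0"
  using clinear_scale[of f 0 0] by simp

lemma clinear_diff: "clinear f \<Longrightarrow> f (x - y) = f x - f y"
  using clinear_add[of f "x - y" y] by (simp add: algebra_simps)

lemma tensor_induct [case_names zero tens add]:
  assumes "P 0" "\<And>x y. P (x \<otimes> y)" "\<And>s t. P s \<Longrightarrow> P t \<Longrightarrow> P (s + t)"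
  shows "P t"
proof (induct t)
  case (1 X)
  show ?case
  proof (induction X)
    case empty
    show ?case using assms(1) by (simp add: zero_tensor_def)
  next
    case (add x X)
    have "abs_tensor (add_mset x X) = fst x \<otimes> snd x + abs_tensor X"
      by (simp add: tens.abs_eq plus_tensor.abs_eq)
    then show ?case by (simp add: assms(2,3) add)
  qed
qed

lemma tens_add_left: "(a + a') \<otimes> b = a \<otimes> b + a' \<otimes> b"
  by transfer (use tensor_rel_left in \<open>simp add: add_mset_commute\<close>)

lemma tens_add_right: "a \<otimes> (b + b') = a \<otimes> b + a \<otimes> b'"
  by transfer (use tensor_rel_right in \<open>simp add: add_mset_commute\<close>)

lemma tens_scale_left: "(c *\<^sub>C a) \<otimes> b = c *\<^sub>C (a \<otimes> b)"
  by transfer (simp add: tensor_rel_refl)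

lemma tens_scale_right: "a \<otimes> (c *\<^sub>C b) = c *\<^sub>C (a \<otimes> b)"
proof -
  have "a \<otimes> (c *\<^sub>C b) = (c *\<^sub>C a) \<otimes> b"
    by transfer (rule tensor_rel_sym, rule tensor_rel_scale)
  then show ?thesis by (simp add: tens_scale_left)
qed

lemma tensor_lift_clinear:
  assumes "balanced f" "\<And>c a b. f (c *\<^sub>C a) b = c *\<^sub>C f a b"
  shows "clinear (tensor_lift f)"
proof -
  have [simp]: "tensor_lift f 0 = 0"
    using tensor_lift_add[OF assms(1), of 0 0] by simp
  have "tensor_lift f (c *\<^sub>C t) = c *\<^sub>C tensor_lift f t" for c t
    by (induction t rule: tensor_induct)
      (auto simp: scaleC_add_right tensor_lift_add assms tensor_lift_tens simp flip: tens_scale_left)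
  then show ?thesis by (simp add: clinear_iff tensor_lift_add assms)
qed

lemma clinear_eq_on_tens:
  assumes "clinear f" "clinear g" "\<And>x y. f (x \<otimes> y) = g (x \<otimes> y)"
  shows "f t = g t"
  by (induction t rule: tensor_induct) (simp_all add: assms clinear_add clinear_zero)

lemma clinear_tensor_map:
  assumes "clinear f" "clinear g"
  shows "clinear (tensor_map f g)" and "tensor_map f g (x \<otimes> y) = f x \<otimes> g y"
proof -
  have *: "balanced (\<lambda>a b. f a \<otimes> g b)"
    by (simp add: balanced_def assms clinear_add clinear_scale tens_add_left tens_add_right
        tens_scale_left tens_scale_right)
  show "clinear (tensor_map f g)"
    unfolding tensor_map_def
    by (rule tensor_lift_clinear[OF *]) (simp add: assms clinear_scale tens_scale_left)
  show "tensor_map f g (x \<otimes> y) = f x \<otimes> g y"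
    unfolding tensor_map_def by (rule tensor_lift_tens[OF *])
qed

section \<open>Positive semidefinite hermitian forms\<close>

text \<open>
  Shared by the inner product of a Hilbert space and the one that two Hilbert spaces induce on their
  algebraic tensor product.
\<close>

locale semi_inner =
  fixes B :: "'v::complex_vector \<Rightarrow> 'v \<Rightarrow> complex"
  assumes herm: "B x y = cnj (B y x)"
    and add_right: "B x (y + z) = B x y + B x z"
    and scale_right: "B x (c *\<^sub>C y) = c * B x y"
    and pos: "0 \<le> Re (B x x)"
begin

lemma add_left: "B (x + y) z = B x z + B y z"
  using herm by (metis add_right complex_cnj_add)

lemma scale_left: "B (c *\<^sub>C x) y = cnj c * B x y"
  using herm by (metis scale_right complex_cnj_mult)

lemma zero_left: "B 0 x = 0" and zero_right: "B x 0 = 0"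
  using scale_left[of 0 0 x] scale_right[of x 0 0] by simp_all

lemma diff_left: "B (x - y) z = B x z - B y z" and diff_right: "B z (x - y) = B z x - B z y"
  using add_left[of "x - y" y z] add_right[of z "x - y" y] by (simp_all add: algebra_simps)

lemma self_eq_Re: "B x x = complex_of_real (Re (B x x))"
  using herm[of x x] by (simp add: complex_eq_iff)

lemma cauchy_schwarz: "cmod (B x y) \<le> sqrt (Re (B x x)) * sqrt (Re (B y y))"
proof -
  define a b d where "a = Re (B x x)" and "b = cmod (B x y)" and "d = Re (B y y)"
  have ad: "0 \<le> a" "0 \<le> d" "0 \<le> b" by (simp_all add: a_def d_def b_def pos)
  \<comment> \<open>Positivity of the form on \<open>x - r \<langle>y, x\<rangle> y\<close>; the phase of the coefficient makes the cross terms real.\<close>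
  have quad: "0 \<le> a - 2 * r * b\<^sup>2 + r\<^sup>2 * b\<^sup>2 * d" for r :: real
  proof -
    define c where "c = - (of_real r * cnj (B x y))"
    have forms: "B y x = cnj (B x y)" "B x x = of_real a" "B y y = of_real d"
      unfolding a_def d_def by (rule herm self_eq_Re)+
    have "B (x + c *\<^sub>C y) (x + c *\<^sub>C y) =
        B x x + c * B x y + cnj c * (B y x + c * B y y)"
      by (simp add: add_left add_right scale_left scale_right algebra_simps)
    also have "\<dots> = complex_of_real (a - 2 * r * b\<^sup>2 + r\<^sup>2 * b\<^sup>2 * d)"
    proof -
      have bb: "cnj (B x y) * B x y = of_real (b\<^sup>2)"
        unfolding b_def by (metis complex_norm_square mult.commute)
      have 1: "c * B x y = - of_real (r * b\<^sup>2)"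
        unfolding c_def mult_minus_left mult.assoc bb of_real_mult ..
      have 2: "cnj c * cnj (B x y) = - of_real (r * b\<^sup>2)"
        using arg_cong[OF 1, of cnj] by simp
      have 3: "cnj c * c = of_real (r\<^sup>2 * b\<^sup>2)"
        unfolding c_def complex_cnj_minus complex_cnj_mult complex_cnj_cnj complex_cnj_complex_of_real
        using bb by (simp add: power2_eq_square mult.commute)
      show ?thesis
        unfolding forms 1 distrib_left 2 mult.assoc[symmetric, of "cnj c"] 3 by simp
    qed
    finally show ?thesis using pos[of "x + c *\<^sub>C y"] by simp
  qed
  have "b\<^sup>2 \<le> a * d"
  proof (cases "d = 0")
    case True
    have "b = 0"
    proof (rule ccontr)
      assume "b \<noteq> 0"
      then have "0 < b\<^sup>2" and "0 \<le> a * b\<^sup>2" using ad by simp_all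
      moreover have "2 * b\<^sup>2 \<le> - (a * b\<^sup>2)"
        using \<open>b \<noteq> 0\<close> quad[of "(a + 1) / b\<^sup>2"] True by (simp add: field_simps)
      ultimately show False by linarith
    qed
    then show ?thesis using True by simp
  next
    case False
    then show ?thesis using quad[of "1 / d"] ad by (simp add: field_simps power2_eq_square)
  qed
  then have "b \<le> sqrt (a * d)" by (rule real_le_rsqrt)
  then show ?thesis unfolding a_def b_def d_def by (simp add: real_sqrt_mult)
qed

lemma triangle: "sqrt (Re (B (x + y) (x + y))) \<le> sqrt (Re (B x x)) + sqrt (Re (B y y))"
proof (rule real_le_lsqrt)
  have "Re (B x y) \<le> sqrt (Re (B x x)) * sqrt (Re (B y y))"
    using complex_Re_le_cmod cauchy_schwarz by (rule order_trans)
  moreover have "Re (B y x) = Re (B x y)" by (subst herm) simp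
  ultimately show "Re (B (x + y) (x + y)) \<le> (sqrt (Re (B x x)) + sqrt (Re (B y y)))\<^sup>2"
    by (simp add: add_left add_right power2_sum pos)
qed (simp add: pos)

lemma scale: "sqrt (Re (B (c *\<^sub>C x) (c *\<^sub>C x))) = cmod c * sqrt (Re (B x x))"
proof -
  have "B (c *\<^sub>C x) (c *\<^sub>C x) = (c * cnj c) * of_real (Re (B x x))"
    by (subst self_eq_Re[symmetric]) (simp add: scale_left scale_right)
  also have "\<dots> = of_real ((cmod c)\<^sup>2 * Re (B x x))"
    unfolding complex_norm_square[symmetric] by simp
  finally show ?thesis by (simp add: real_sqrt_mult)
qed

end

global_interpretation cinner: semi_inner "cinner :: 'h \<Rightarrow> 'h::chilbert_space \<Rightarrow> complex"
  by unfold_locales (rule cinner_commute cinner_add_right cinner_scaleC_right | simp add: Re_cinner_self)+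

lemma cinner_cauchy_schwarz: "cmod (cinner x y) \<le> norm x * norm y"
  using cinner.cauchy_schwarz[of x y] by (simp only: norm_eq_sqrt_cinner)

lemma tendsto_cinner_left:
  fixes X :: "nat \<Rightarrow> 'h::chilbert_space"
  assumes "X \<longlonglongrightarrow> x"
  shows "(\<lambda>n. cinner (X n) y) \<longlonglongrightarrow> cinner x y"
proof -
  have "bounded_linear (\<lambda>x. cinner x y)"
  proof (rule bounded_linear_intro)
    show "norm (cinner x y) \<le> norm x * norm y" for x
      by (rule cinner_cauchy_schwarz)
  qed (simp_all add: cinner_add_left scaleR_scaleC cinner_scaleC_left scaleC_complex_def)
  then show ?thesis using assms by (rule bounded_linear.tendsto)
qed

lemma norm_scaleC: "norm (c *\<^sub>C x) = cmod c * norm x" for x :: "'h::chilbert_space"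
  using cinner.scale[of c x] by (simp only: norm_eq_sqrt_cinner)

lemma tendsto_scaleC:
  fixes X :: "nat \<Rightarrow> 'h::chilbert_space"
  assumes "X \<longlonglongrightarrow> x"
  shows "(\<lambda>n. c *\<^sub>C X n) \<longlonglongrightarrow> c *\<^sub>C x"
proof -
  have "bounded_linear (\<lambda>x::'h. c *\<^sub>C x)"
    by (rule bounded_linear_intro[where K="cmod c"])
      (simp_all add: scaleC_add_right scaleR_scaleC scaleC_scaleC norm_scaleC mult.commute)
  then show ?thesis using assms by (rule bounded_linear.tendsto)
qed

section \<open>The inner product on a tensor product of Hilbert spaces\<close>

lemma tensor_cinner_add_right: "tensor_cinner u (v + w) = tensor_cinner u v + tensor_cinner u w"
  and tensor_cinner_scale_right: "tensor_cinner u (c *\<^sub>C v) = c * tensor_cinner u v"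
  and tensor_cinner_add_left: "tensor_cinner (u + v) w = tensor_cinner u w + tensor_cinner v w"
proof -
  let ?f = "\<lambda>x y x' y'. cinner x x' * cinner y y'"
  have b: "balanced (?f x y)" for x :: 'a and y :: 'b
    by (simp add: balanced_def cinner_add_right cinner_scaleC_right algebra_simps)
  have lin: "clinear (tensor_lift (?f x y))" for x :: 'a and y :: 'b
    by (rule tensor_lift_clinear[OF b]) (simp add: cinner_scaleC_right scaleC_complex_def)
  show "tensor_cinner u (v + w) = tensor_cinner u v + tensor_cinner u w"
    unfolding tensor_cinner_def clinear_add[OF lin] tensor_lift_def[of _ u]
    by (simp add: case_prod_unfold sum_mset.distrib)
  show "tensor_cinner u (c *\<^sub>C v) = c * tensor_cinner u v"
    unfolding tensor_cinner_def clinear_scale[OF lin] tensor_lift_def[of _ u]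
    by (simp add: case_prod_unfold sum_mset_distrib_left scaleC_complex_def)
  have "balanced (\<lambda>x y. tensor_lift (?f x y) v)" for v
    unfolding balanced_def tensor_lift_def
    by (simp add: case_prod_unfold cinner_add_left cinner_scaleC_left distrib_left distrib_right
        sum_mset.distrib mult_ac)
  then show "tensor_cinner (u + v) w = tensor_cinner u w + tensor_cinner v w"
    unfolding tensor_cinner_def by (rule tensor_lift_add)
qed

lemma tensor_cinner_zero: "tensor_cinner u 0 = 0" "tensor_cinner 0 u = 0"
  using tensor_cinner_add_right[of u 0 0] tensor_cinner_add_left[of 0 0 u] by simp_all

lemma tensor_cinner_commute: "tensor_cinner u v = cnj (tensor_cinner v u)"
proof (induction u rule: tensor_induct)
  case (tens x y)
  show ?case
    by (induction v rule: tensor_induct)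
      (simp_all add: tensor_cinner_zero tensor_cinner_add_left tensor_cinner_add_right
        tensor_cinner_tens cinner_commute[of x] cinner_commute[of y])
qed (simp_all add: tensor_cinner_zero tensor_cinner_add_left tensor_cinner_add_right)

lemma cinner_sum_right: "cinner x (\<Sum>i\<in>I. f i) = (\<Sum>i\<in>I. cinner x (f i))"
  by (induction I rule: infinite_finite_induct) (use cinner_scaleC_right[of x 0] in \<open>simp_all add: cinner_add_right\<close>)

lemma tens_sum_right: "x \<otimes> (\<Sum>i\<in>I. f i) = (\<Sum>i\<in>I. x \<otimes> f i)"
  by (induction I rule: infinite_finite_induct)
    (use tens_scale_right[of x 0] in \<open>simp_all add: tens_add_right\<close>)

lemma tensor_cinner_sum_left: "tensor_cinner (\<Sum>i\<in>I. f i) v = (\<Sum>i\<in>I. tensor_cinner (f i) v)"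
  by (induction I rule: infinite_finite_induct) (simp_all add: tensor_cinner_add_left tensor_cinner_zero)

lemma tensor_cinner_sum_right: "tensor_cinner v (\<Sum>i\<in>I. f i) = (\<Sum>i\<in>I. tensor_cinner v (f i))"
  by (induction I rule: infinite_finite_induct) (simp_all add: tensor_cinner_add_right tensor_cinner_zero)

text \<open>
  Gram--Schmidt on the second factors: when \<open>a \<otimes> y\<close> is added, \<open>y\<close> splits into a combination of the
  vectors already present and a vector orthogonal to them, and the combination is moved to the first
  factor. Leaving the vectors unnormalised means that a vector equal to zero causes no case
  distinction in the result.
\<close>

lemma orthogonal_expansion:
  fixes u :: "('h::complex_vector, 'k::chilbert_space) tensor"
  shows "\<exists>(n::nat) x e. u = (\<Sum>i<n. x i \<otimes> e i) \<and> (\<forall>i<n. \<forall>j<n. i \<noteq> j \<longrightarrow> cinner (e i) (e j) = 0)"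
proof -
  have step: "\<exists>(n::nat) x e. (\<Sum>i<n0. x0 i \<otimes> e0 i) + a \<otimes> y = (\<Sum>i<n. x i \<otimes> e i) \<and>
      (\<forall>i<n. \<forall>j<n. i \<noteq> j \<longrightarrow> cinner (e i) (e j) = 0)"
    if orth: "\<forall>i<n0. \<forall>j<n0. i \<noteq> j \<longrightarrow> cinner (e0 i) (e0 j) = 0"
    for n0 and x0 :: "nat \<Rightarrow> 'h" and e0 :: "nat \<Rightarrow> 'k" and a y
  proof -
    \<comment> \<open>For \<open>e0 i = 0\<close> the coefficient is \<open>0 / 0 = 0\<close>, and orthogonality to \<open>e0 i\<close> is trivial.\<close>
    define c where "c i = cinner (e0 i) y / cinner (e0 i) (e0 i)" for i
    define y' where "y' = y - (\<Sum>i<n0. c i *\<^sub>C e0 i)"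
    have y: "y = y' + (\<Sum>i<n0. c i *\<^sub>C e0 i)" by (simp add: y'_def)
    have perp: "cinner (e0 j) y' = 0" if j: "j < n0" for j
    proof -
      have "cinner (e0 j) (\<Sum>i<n0. c i *\<^sub>C e0 i) = (\<Sum>i<n0. if i = j then c j * cinner (e0 j) (e0 j) else 0)"
        unfolding cinner_sum_right cinner_scaleC_right by (rule sum.cong) (use orth j in auto)
      also have "\<dots> = c j * cinner (e0 j) (e0 j)" using j by simp
      also have "\<dots> = cinner (e0 j) y"
      proof (cases "e0 j = 0")
        case True
        then show ?thesis using cinner_scaleC_left[of 0 0 y] by (simp add: c_def)
      next
        case False
        then have "cinner (e0 j) (e0 j) \<noteq> 0" using Re_cinner_self[of "e0 j"] by auto
        then show ?thesis by (simp add: c_def)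
      qed
      finally have "cinner (e0 j) y = cinner (e0 j) y' + cinner (e0 j) y"
        using cinner_add_right[of "e0 j" y' "\<Sum>i<n0. c i *\<^sub>C e0 i"] y by simp
      then show ?thesis by simp
    qed
    then have perp': "cinner y' (e0 j) = 0" if "j < n0" for j
      using that cinner_commute[of y' "e0 j"] by simp
    define x where "x = (\<lambda>i. if i = n0 then a else x0 i + c i *\<^sub>C a)"
    define e where "e = (\<lambda>i. if i = n0 then y' else e0 i)"
    have "(\<Sum>i<Suc n0. x i \<otimes> e i) = (\<Sum>i<n0. x0 i \<otimes> e0 i + a \<otimes> (c i *\<^sub>C e0 i)) + a \<otimes> y'"
      by (simp add: x_def e_def tens_add_left tens_scale_left tens_scale_right)
    also have "\<dots> = (\<Sum>i<n0. x0 i \<otimes> e0 i) + a \<otimes> y"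
    proof -
      have "a \<otimes> y = a \<otimes> y' + (\<Sum>i<n0. a \<otimes> (c i *\<^sub>C e0 i))"
        by (subst y) (simp only: tens_add_right tens_sum_right)
      then show ?thesis by (simp add: sum.distrib ac_simps)
    qed
    finally have sum_eq: "(\<Sum>i<Suc n0. x i \<otimes> e i) = (\<Sum>i<n0. x0 i \<otimes> e0 i) + a \<otimes> y" .
    have orth': "\<forall>i<Suc n0. \<forall>j<Suc n0. i \<noteq> j \<longrightarrow> cinner (e i) (e j) = 0"
    proof (intro allI impI)
      fix i j assume "i < Suc n0" "j < Suc n0" "i \<noteq> j"
      then consider "i = n0" "j < n0" | "j = n0" "i < n0" | "i < n0" "j < n0" "i \<noteq> j"
        by linarith
      then show "cinner (e i) (e j) = 0"
        by cases (simp_all add: e_def perp perp' orth)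
    qed
    show ?thesis
    proof (intro exI conjI)
      show "(\<Sum>i<n0. x0 i \<otimes> e0 i) + a \<otimes> y = (\<Sum>i<Suc n0. x i \<otimes> e i)"
        using sum_eq by (rule sym)
      show "\<forall>i<Suc n0. \<forall>j<Suc n0. i \<noteq> j \<longrightarrow> cinner (e i) (e j) = 0"
        by (rule orth')
    qed
  qed
  \<comment> \<open>For the sum of two tensors the second one is absorbed into an expansion of the first, so the induction starts from an arbitrary orthogonal expansion.\<close>
  have "\<exists>(n::nat) x e. (\<Sum>i<n0. x0 i \<otimes> e0 i) + u = (\<Sum>i<n. x i \<otimes> e i) \<and>
      (\<forall>i<n. \<forall>j<n. i \<noteq> j \<longrightarrow> cinner (e i) (e j) = 0)"
    if "\<forall>i<n0. \<forall>j<n0. i \<noteq> j \<longrightarrow> cinner (e0 i) (e0 j) = 0"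
    for n0 and x0 :: "nat \<Rightarrow> 'h" and e0 :: "nat \<Rightarrow> 'k"
    using that
  proof (induction u arbitrary: n0 x0 e0 rule: tensor_induct)
    case zero
    then show ?case by auto
  next
    case (tens x y)
    then show ?case by (rule step)
  next
    case (add s t)
    from add.IH(1)[OF add.prems] obtain n :: nat and x e where
      *: "(\<Sum>i<n0. x0 i \<otimes> e0 i) + s = (\<Sum>i<n. x i \<otimes> e i)"
      and o: "\<forall>i<n. \<forall>j<n. i \<noteq> j \<longrightarrow> cinner (e i) (e j) = 0" by blast
    show ?case unfolding add.assoc[symmetric] * by (rule add.IH(2)[OF o])
  qed
  from this[of 0] show ?thesis by simp
qed

lemma tensor_cinner_orthogonal:
  fixes n :: nat
  assumes "\<forall>i<n. \<forall>j<n. i \<noteq> j \<longrightarrow> cinner (e i) (e j) = 0"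
  shows "Re (tensor_cinner (\<Sum>i<n. x i \<otimes> e i) (\<Sum>i<n. x i \<otimes> e i)) =
    (\<Sum>i<n. (norm (x i))\<^sup>2 * (norm (e i))\<^sup>2)"
proof -
  have "tensor_cinner (\<Sum>i<n. x i \<otimes> e i) (\<Sum>i<n. x i \<otimes> e i) =
      (\<Sum>j<n. \<Sum>i<n. cinner (x i) (x j) * cinner (e i) (e j))"
    by (simp add: tensor_cinner_sum_left tensor_cinner_sum_right tensor_cinner_tens)
  also have "\<dots> = (\<Sum>j<n. \<Sum>i<n. if i = j then cinner (x j) (x j) * cinner (e j) (e j) else 0)"
    by (intro sum.cong refl) (use assms in auto)
  also have "\<dots> = (\<Sum>j<n. cinner (x j) (x j) * cinner (e j) (e j))"
    by simp
  also have "\<dots> = of_real (\<Sum>j<n. (norm (x j))\<^sup>2 * (norm (e j))\<^sup>2)"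
    by (subst (1 2) cinner.self_eq_Re) (simp add: Re_cinner_self)
  finally show ?thesis by simp
qed

global_interpretation tensor_cinner: semi_inner "tensor_cinner :: ('h::chilbert_space, 'k::chilbert_space) tensor \<Rightarrow> _"
proof
  fix u v w :: "('h, 'k) tensor" and c
  obtain n :: nat and x e where "u = (\<Sum>i<n. x i \<otimes> e i)"
    "\<forall>i<n. \<forall>j<n. i \<noteq> j \<longrightarrow> cinner (e i) (e j) = 0"
    using orthogonal_expansion by blast
  then show "0 \<le> Re (tensor_cinner u u)"
    by (simp add: tensor_cinner_orthogonal sum_nonneg)
qed (rule tensor_cinner_commute tensor_cinner_add_right tensor_cinner_scale_right)+

lemma tensor_norm_ge_0: "0 \<le> tensor_norm u"
  by (simp add: tensor_norm_def tensor_cinner.pos)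

lemma tensor_norm_square: "(tensor_norm u)\<^sup>2 = Re (tensor_cinner u u)"
  by (simp add: tensor_norm_def tensor_cinner.pos)

lemma tensor_norm_triangle: "tensor_norm (u + v) \<le> tensor_norm u + tensor_norm v"
  unfolding tensor_norm_def by (rule tensor_cinner.triangle)

lemma tensor_cinner_cauchy_schwarz: "cmod (tensor_cinner u v) \<le> tensor_norm u * tensor_norm v"
  unfolding tensor_norm_def by (rule tensor_cinner.cauchy_schwarz)

lemma tensor_norm_scale: "tensor_norm (c *\<^sub>C u) = cmod c * tensor_norm u"
  unfolding tensor_norm_def by (rule tensor_cinner.scale)

lemma tensor_norm_zero: "tensor_norm 0 = 0"
  by (simp add: tensor_norm_def tensor_cinner_zero)

text \<open>
  In an orthogonal expansion \<open>\<Sum>i. x i \<otimes> e i\<close> the operator only changes the \<open>x i\<close>, and the square of the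
  norm is \<open>\<Sum>i. \<parallel>x i\<parallel>\<^sup>2 \<parallel>e i\<parallel>\<^sup>2\<close> both before and after.
\<close>

lemma tensor_norm_map_id:
  fixes A :: "'h::chilbert_space \<Rightarrow>\<^sub>L 'h2::chilbert_space"
    and u :: "('h, 'k::chilbert_space) tensor"
  assumes "clinear (blinfun_apply A)"
  shows "tensor_norm (tensor_map (blinfun_apply A) (\<lambda>y. y) u) \<le> norm A * tensor_norm u"
proof -
  obtain n :: nat and x e where u: "u = (\<Sum>i<n. x i \<otimes> e i)"
    and o: "\<forall>i<n. \<forall>j<n. i \<noteq> j \<longrightarrow> cinner (e i) (e j) = 0"
    using orthogonal_expansion by blast
  have id: "clinear (\<lambda>y::'k. y)" by (simp add: clinear_iff)
  note lin = clinear_tensor_map[OF assms id]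
  have "tensor_map A (\<lambda>y. y) (\<Sum>i<m. x i \<otimes> e i) = (\<Sum>i<m. A (x i) \<otimes> e i)" for m
    by (induction m) (simp_all add: lin(2) clinear_add[OF lin(1)] clinear_zero[OF lin(1)])
  then have "(tensor_norm (tensor_map A (\<lambda>y. y) u))\<^sup>2 = (\<Sum>i<n. (norm (A (x i)))\<^sup>2 * (norm (e i))\<^sup>2)"
    by (simp add: u tensor_norm_square tensor_cinner_orthogonal[OF o])
  also have "\<dots> \<le> (\<Sum>i<n. (norm A * norm (x i))\<^sup>2 * (norm (e i))\<^sup>2)"
    by (intro sum_mono mult_right_mono power_mono norm_blinfun) simp_all
  also have "\<dots> = (norm A)\<^sup>2 * (tensor_norm u)\<^sup>2"
    by (simp add: u tensor_norm_square tensor_cinner_orthogonal[OF o] sum_distrib_left power_mult_distrib mult.assoc)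
  finally show ?thesis
    by (intro power2_le_imp_le[OF _ mult_nonneg_nonneg]) (simp_all add: power_mult_distrib tensor_norm_ge_0)
qed

text \<open>
  The flip is isometric, so it carries estimates for operators on the first factor over to the second
  factor.
\<close>

definition tensor_swap :: "('a::complex_vector, 'b::complex_vector) tensor \<Rightarrow> ('b, 'a) tensor"
  where "tensor_swap = tensor_lift (\<lambda>a b. b \<otimes> a)"

lemma
  fixes a :: "'a::complex_vector" and b :: "'b::complex_vector"
  shows clinear_tensor_swap: "clinear (tensor_swap :: ('a, 'b) tensor \<Rightarrow> _)"
    and tensor_swap_tens: "tensor_swap (a \<otimes> b) = b \<otimes> a"
proof -
  have *: "balanced (\<lambda>(a::'a) (b::'b). b \<otimes> a)"
    by (simp add: balanced_def tens_add_left tens_add_right tens_scale_left tens_scale_right)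
  show "clinear (tensor_swap :: ('a, 'b) tensor \<Rightarrow> _)"
    unfolding tensor_swap_def by (rule tensor_lift_clinear[OF *]) (simp add: tens_scale_right)
  show "tensor_swap (a \<otimes> b) = b \<otimes> a"
    unfolding tensor_swap_def by (rule tensor_lift_tens[OF *])
qed

lemma tensor_cinner_swap: "tensor_cinner (tensor_swap u) (tensor_swap v) = tensor_cinner u v"
proof (induction u rule: tensor_induct)
  case (tens x y)
  show ?case
    by (induction v rule: tensor_induct)
      (simp_all add: tensor_cinner_zero tensor_cinner_add_right tensor_cinner_tens tensor_swap_tens
        clinear_zero[OF clinear_tensor_swap] clinear_add[OF clinear_tensor_swap])
qed (simp_all add: tensor_cinner_zero tensor_cinner_add_left
    clinear_zero[OF clinear_tensor_swap] clinear_add[OF clinear_tensor_swap])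

lemma tensor_norm_swap: "tensor_norm (tensor_swap u) = tensor_norm u"
  by (simp add: tensor_norm_def tensor_cinner_swap)

lemma clinear_id: "clinear (\<lambda>x::'a::complex_vector. x)"
  by (simp add: clinear_iff)

lemma clinear_compose: "clinear f \<Longrightarrow> clinear g \<Longrightarrow> clinear (\<lambda>x. f (g x))"
  by (simp add: clinear_iff)

lemma tensor_norm_map:
  fixes A :: "'h::chilbert_space \<Rightarrow>\<^sub>L 'h2::chilbert_space"
    and B :: "'k::chilbert_space \<Rightarrow>\<^sub>L 'k2::chilbert_space"
  assumes A: "clinear (blinfun_apply A)" and B: "clinear (blinfun_apply B)"
  shows "tensor_norm (tensor_map (blinfun_apply A) (blinfun_apply B) u) \<le> norm A * norm B * tensor_norm u"
proof -
  note lin = clinear_tensor_map[OF A B] clinear_tensor_map[OF A clinear_id]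
    clinear_tensor_map[OF B clinear_id]
  let ?v = "tensor_swap (tensor_map B (\<lambda>y. y) (tensor_swap u))"
  have "tensor_map A B u = tensor_map A (\<lambda>y. y) ?v"
    by (rule clinear_eq_on_tens[OF lin(1)])
      (auto intro!: clinear_compose[OF lin(3)] clinear_compose[OF lin(5)]
          clinear_compose[OF clinear_tensor_swap] clinear_tensor_swap
        simp: tensor_swap_tens lin)
  then have "tensor_norm (tensor_map A B u) \<le> norm A * tensor_norm ?v"
    using tensor_norm_map_id[OF A] by simp
  also have "\<dots> \<le> norm A * (norm B * tensor_norm u)"
    unfolding tensor_norm_swap
    by (intro mult_left_mono order_trans[OF tensor_norm_map_id[OF B]]) (simp_all add: tensor_norm_swap)
  finally show ?thesis by (simp add: mult.assoc)
qed

section \<open>Tensor products of representations and the spatial norm\<close>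

lemma star_repD:
  assumes "star_rep \<rho>"
  shows "clinear (blinfun_apply (\<rho> a))"
    and "\<rho> (a + b) = \<rho> a + \<rho> b"
    and "blinfun_apply (\<rho> (c *\<^sub>C a)) x = c *\<^sub>C blinfun_apply (\<rho> a) x"
    and "\<rho> (a * b) = \<rho> a o\<^sub>L \<rho> b"
    and "cinner (blinfun_apply (\<rho> (star a)) x) y = cinner x (blinfun_apply (\<rho> a) y)"
  using assms by (auto simp: star_rep_def)

lemma star_rep_diff: "star_rep \<rho> \<Longrightarrow> \<rho> (a - b) = \<rho> a - \<rho> b"
  using star_repD(2)[of \<rho> "a - b" b] by (simp add: algebra_simps)

context
  fixes \<rho> :: "'a::complex_star_algebra \<Rightarrow> ('h::chilbert_space \<Rightarrow>\<^sub>L 'h)"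
    and \<sigma> :: "'b::complex_star_algebra \<Rightarrow> ('k::chilbert_space \<Rightarrow>\<^sub>L 'k)"
  assumes \<rho>: "star_rep \<rho>" and \<sigma>: "star_rep \<sigma>"
begin

lemmas rep_map = clinear_tensor_map[OF star_repD(1)[OF \<rho>] star_repD(1)[OF \<sigma>]]

lemma tensor_rep_tens:
    "tensor_rep \<rho> \<sigma> (a \<otimes> b) u = tensor_map (blinfun_apply (\<rho> a)) (blinfun_apply (\<sigma> b)) u"
  and clinear_tensor_rep_left: "clinear (\<lambda>t. tensor_rep \<rho> \<sigma> t u)"
proof -
  let ?f = "\<lambda>a b. tensor_map (blinfun_apply (\<rho> a)) (blinfun_apply (\<sigma> b)) u"
  have add1: "?f (a + a') b = ?f a b + ?f a' b" for a a' b
    by (induction u rule: tensor_induct)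
      (simp_all only: rep_map clinear_zero[OF rep_map(1)] clinear_add[OF rep_map(1)],
        simp_all add: star_repD(2)[OF \<rho>]
        blinfun.add_left tens_add_left)
  have add2: "?f a (b + b') = ?f a b + ?f a b'" for a b b'
    by (induction u rule: tensor_induct)
      (simp_all only: rep_map clinear_zero[OF rep_map(1)] clinear_add[OF rep_map(1)],
        simp_all add: star_repD(2)[OF \<sigma>]
        blinfun.add_left tens_add_right)
  have scale1: "?f (c *\<^sub>C a) b = c *\<^sub>C ?f a b" for c a b
    by (induction u rule: tensor_induct)
      (simp_all only: rep_map clinear_zero[OF rep_map(1)] clinear_add[OF rep_map(1)],
        simp_all add: star_repD(3)[OF \<rho>]
        tens_scale_left scaleC_add_right)
  have scale2: "?f a (c *\<^sub>C b) = c *\<^sub>C ?f a b" for c a b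
    by (induction u rule: tensor_induct)
      (simp_all only: rep_map clinear_zero[OF rep_map(1)] clinear_add[OF rep_map(1)],
        simp_all add: star_repD(3)[OF \<sigma>]
        tens_scale_right scaleC_add_right)
  have *: "balanced ?f"
    by (simp add: balanced_def add1 add2 scale1 scale2)
  show "tensor_rep \<rho> \<sigma> (a \<otimes> b) u = ?f a b"
    unfolding tensor_rep_def by (rule tensor_lift_tens[OF *])
  show "clinear (\<lambda>t. tensor_rep \<rho> \<sigma> t u)"
    unfolding tensor_rep_def by (rule tensor_lift_clinear[OF * scale1])
qed

lemma clinear_tensor_rep: "clinear (tensor_rep \<rho> \<sigma> t)"
proof (induction t rule: tensor_induct)
  case zero
  then show ?case
    by (simp add: clinear_iff clinear_zero[OF clinear_tensor_rep_left])
next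
  case (tens a b)
  then show ?case
    using rep_map(1)[of a b] by (simp add: clinear_iff tensor_rep_tens)
next
  case (add s t)
  then show ?case
    by (simp add: clinear_iff clinear_add[OF clinear_tensor_rep_left] scaleC_add_right)
qed

lemmas tensor_rep_zero = clinear_zero[OF clinear_tensor_rep_left] clinear_zero[OF clinear_tensor_rep]
lemmas tensor_rep_add = clinear_add[OF clinear_tensor_rep_left] clinear_add[OF clinear_tensor_rep]
lemmas tensor_rep_scale = clinear_scale[OF clinear_tensor_rep_left] clinear_scale[OF clinear_tensor_rep]

lemma tensor_rep_tens_tens:
  "tensor_rep \<rho> \<sigma> (a \<otimes> b) (x \<otimes> y) = blinfun_apply (\<rho> a) x \<otimes> blinfun_apply (\<sigma> b) y"
  by (simp add: tensor_rep_tens rep_map)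

lemma tensor_rep_mult: "tensor_rep \<rho> \<sigma> (s * t) u = tensor_rep \<rho> \<sigma> s (tensor_rep \<rho> \<sigma> t u)"
proof (induction s rule: tensor_induct)
  case (tens a b)
  show ?case
  proof (induction t rule: tensor_induct)
    case (tens a' b')
    show ?case
      by (induction u rule: tensor_induct)
        (simp_all add: tens_mult tensor_rep_zero tensor_rep_add tensor_rep_tens_tens
          star_repD(4)[OF \<rho>] star_repD(4)[OF \<sigma>])
  qed (simp_all add: tensor_rep_zero tensor_rep_add distrib_left)
qed (simp_all add: tensor_rep_zero tensor_rep_add distrib_right)

lemma star_tensor_zero: "star (0 :: ('a, 'b) tensor) = 0"
  using star_scaleC[of 0 "0 :: ('a, 'b) tensor"] by simp

lemma tensor_rep_star:
  "tensor_cinner (tensor_rep \<rho> \<sigma> (star t) u) v = tensor_cinner u (tensor_rep \<rho> \<sigma> t v)"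
proof (induction t rule: tensor_induct)
  case (tens a b)
  show ?case
  proof (induction u rule: tensor_induct)
    case (tens x y)
    show ?case
      by (induction v rule: tensor_induct)
        (simp_all add: star_tens tensor_rep_zero tensor_rep_add tensor_rep_tens_tens tensor_cinner_tens
          tensor_cinner_zero tensor_cinner_add_right star_repD(5)[OF \<rho>] star_repD(5)[OF \<sigma>])
  qed (simp_all add: tensor_rep_zero tensor_rep_add tensor_cinner_zero tensor_cinner_add_left)
qed (simp_all add: tensor_rep_zero tensor_rep_add tensor_cinner_zero tensor_cinner_add_left
    tensor_cinner_add_right star_add star_tensor_zero)

text \<open>
  This crude bound, which depends on a representative of the tensor but not on the representations,
  makes the suprema defining the operator norm and the spatial norm suprema of bounded sets.
\<close>

lemma tensor_rep_norm_bounded: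
  assumes "\<And>a. norm (\<rho> a) \<le> N a" "\<And>b. norm (\<sigma> b) \<le> M b"
  shows "tensor_norm (tensor_rep \<rho> \<sigma> t u) \<le> (\<Sum>(a, b)\<in>#rep_tensor t. N a * M b) * tensor_norm u"
proof -
  have "tensor_norm (\<Sum>(a, b)\<in>#X. tensor_map (blinfun_apply (\<rho> a)) (blinfun_apply (\<sigma> b)) u)
      \<le> (\<Sum>(a, b)\<in>#X. N a * M b) * tensor_norm u" for X
  proof (induction X)
    case empty
    then show ?case by (simp add: tensor_norm_zero)
  next
    case (add p X)
    obtain a b where p: "p = (a, b)" by (cases p)
    have "tensor_norm (tensor_map (blinfun_apply (\<rho> a)) (blinfun_apply (\<sigma> b)) u)
        \<le> norm (\<rho> a) * norm (\<sigma> b) * tensor_norm u"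
      by (rule tensor_norm_map[OF star_repD(1)[OF \<rho>] star_repD(1)[OF \<sigma>]])
    also have "\<dots> \<le> N a * M b * tensor_norm u"
      using assms(1)[of a] by (intro mult_right_mono mult_mono assms tensor_norm_ge_0 norm_ge_zero order_trans[OF norm_ge_zero])
    finally show ?case
      unfolding p using add.IH
      by (auto simp: distrib_right intro!: order_trans[OF tensor_norm_triangle])
  qed
  then show ?thesis unfolding tensor_rep_def tensor_lift_def by blast
qed

end

lemma tensor_opnorm_le:
  assumes "\<And>u. tensor_norm (T u) \<le> C * tensor_norm u" "0 \<le> C"
  shows "tensor_opnorm T \<le> C"
  unfolding tensor_opnorm_def
proof (rule cSup_least)
  show "{tensor_norm (T u) |u. tensor_norm u \<le> 1} \<noteq> {}"
    by (auto simp: tensor_norm_zero intro!: exI[of _ 0])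
  show "x \<le> C" if "x \<in> {tensor_norm (T u) |u. tensor_norm u \<le> 1}" for x
    using that assms by (auto intro!: order_trans[OF assms(1)] mult_left_le)
qed

lemma bdd_above_tensor_opnorm:
  assumes "\<And>u. tensor_norm (T u) \<le> C * tensor_norm u" "0 \<le> C"
  shows "bdd_above {tensor_norm (T u) |u. tensor_norm u \<le> 1}"
  using assms(2) by (auto intro!: bdd_aboveI[of _ C] order_trans[OF assms(1)] mult_left_le)

lemma tensor_opnorm_nonneg:
  assumes "\<And>u. tensor_norm (T u) \<le> C * tensor_norm u" "0 \<le> C"
  shows "0 \<le> tensor_opnorm T"
proof -
  have "tensor_norm (T 0) \<le> tensor_opnorm T"
    unfolding tensor_opnorm_def
    by (rule cSup_upper[OF _ bdd_above_tensor_opnorm[OF assms]]) (auto simp: tensor_norm_zero intro!: exI[of _ 0])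
  then show ?thesis using tensor_norm_ge_0 order_trans by blast
qed

lemma tensor_norm_le_opnorm:
  assumes T: "\<And>u. tensor_norm (T u) \<le> C * tensor_norm u" and "clinear T" and C: "0 \<le> C"
  shows "tensor_norm (T u) \<le> tensor_opnorm T * tensor_norm u"
proof (cases "tensor_norm u = 0")
  case True
  then show ?thesis using T[of u] by simp
next
  case False
  then have pos: "0 < tensor_norm u" using tensor_norm_ge_0[of u] by simp
  define v where "v = complex_of_real (1 / tensor_norm u) *\<^sub>C u"
  have "tensor_norm v = 1" using pos by (simp add: v_def tensor_norm_scale norm_divide)
  have "tensor_norm (T v) \<le> tensor_opnorm T"
    unfolding tensor_opnorm_def using \<open>tensor_norm v = 1\<close>
    by (intro cSup_upper bdd_above_tensor_opnorm[OF T C]) auto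
  moreover have "tensor_norm (T v) = tensor_norm (T u) / tensor_norm u"
    using pos by (simp add: v_def clinear_scale[OF \<open>clinear T\<close>] tensor_norm_scale norm_divide)
  ultimately show ?thesis using pos by (simp add: field_simps)
qed

definition contractive_rep ::
  "('a::complex_star_algebra \<Rightarrow> real) \<Rightarrow> ('a \<Rightarrow> ('h::chilbert_space \<Rightarrow>\<^sub>L 'h)) \<Rightarrow> bool"
  where "contractive_rep N \<rho> \<longleftrightarrow> star_rep \<rho> \<and> (\<forall>a. norm (\<rho> a) \<le> N a)"

lemma spatial_norm_alt:
  "spatial_norm N M t = Sup {tensor_opnorm (tensor_rep \<rho> \<sigma> t) | \<rho> \<sigma>.
    contractive_rep N (\<rho> :: 'a::complex_star_algebra \<Rightarrow> ('a ell2 \<Rightarrow>\<^sub>L 'a ell2)) \<and>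
    contractive_rep M (\<sigma> :: 'b::complex_star_algebra \<Rightarrow> ('b ell2 \<Rightarrow>\<^sub>L 'b ell2))}"
  unfolding spatial_norm_def contractive_rep_def by meson

lemma contractive_rep_zero: "(\<And>a. 0 \<le> N a) \<Longrightarrow> contractive_rep N (\<lambda>_. 0)"
  unfolding contractive_rep_def star_rep_def
  by (auto simp: clinear_iff blinfun.zero_left cinner.zero_left cinner.zero_right)

text \<open>
  This and the next lemma are the two halves of the universal property of the spatial norm: it is the
  least nonnegative constant bounding all tensor products of contractive representations on the two
  sequence spaces. Every property of the spatial norm below is derived from them.
\<close>

lemma spatial_norm_upper:
  fixes \<rho> :: "'a::complex_star_algebra \<Rightarrow> ('a ell2 \<Rightarrow>\<^sub>L 'a ell2)"
    and \<sigma> :: "'b::complex_star_algebra \<Rightarrow> ('b ell2 \<Rightarrow>\<^sub>L 'b ell2)"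
  assumes "contractive_rep N \<rho>" "contractive_rep M \<sigma>"
  shows tensor_norm_rep_le_spatial_norm:
      "tensor_norm (tensor_rep \<rho> \<sigma> t u) \<le> spatial_norm N M t * tensor_norm u"
    and "0 \<le> spatial_norm N M t"
proof -
  define C where "C = (\<Sum>(a, b)\<in>#rep_tensor t. N a * M b)"
  have N: "0 \<le> N a" and M: "0 \<le> M b" for a b
    using assms norm_ge_zero unfolding contractive_rep_def by (meson order_trans)+
  have "0 \<le> (\<Sum>(a, b)\<in>#X. N a * M b)" for X
    by (induction X) (auto simp: N M)
  then have C: "0 \<le> C" unfolding C_def .
  have le: "tensor_norm (tensor_rep \<rho>' \<sigma>' t u) \<le> C * tensor_norm u"
    if "contractive_rep N \<rho>'" "contractive_rep M \<sigma>'"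
    for \<rho>' :: "'a \<Rightarrow> ('a ell2 \<Rightarrow>\<^sub>L 'a ell2)" and \<sigma>' :: "'b \<Rightarrow> ('b ell2 \<Rightarrow>\<^sub>L 'b ell2)" and u
    unfolding C_def using that tensor_rep_norm_bounded[of \<rho>' \<sigma>' N M] by (auto simp: contractive_rep_def)
  have upper: "tensor_opnorm (tensor_rep \<rho> \<sigma> t) \<le> spatial_norm N M t"
    unfolding spatial_norm_alt
  proof (rule cSup_upper)
    show "bdd_above {tensor_opnorm (tensor_rep \<rho> \<sigma> t) |(\<rho> :: 'a \<Rightarrow> ('a ell2 \<Rightarrow>\<^sub>L 'a ell2)) (\<sigma> :: 'b \<Rightarrow> ('b ell2 \<Rightarrow>\<^sub>L 'b ell2)).
        contractive_rep N \<rho> \<and> contractive_rep M \<sigma>}"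
      by (auto intro!: bdd_aboveI[of _ C] tensor_opnorm_le le C)
  qed (use assms in blast)
  have "0 \<le> tensor_opnorm (tensor_rep \<rho> \<sigma> t)"
    by (rule tensor_opnorm_nonneg[OF le[OF assms] C])
  then show "0 \<le> spatial_norm N M t" using upper by linarith
  have "tensor_norm (tensor_rep \<rho> \<sigma> t u) \<le> tensor_opnorm (tensor_rep \<rho> \<sigma> t) * tensor_norm u"
    by (rule tensor_norm_le_opnorm[OF le[OF assms] _ C])
      (use assms in \<open>simp add: contractive_rep_def clinear_tensor_rep\<close>)
  also have "\<dots> \<le> spatial_norm N M t * tensor_norm u"
    by (rule mult_right_mono[OF upper tensor_norm_ge_0])
  finally show "tensor_norm (tensor_rep \<rho> \<sigma> t u) \<le> spatial_norm N M t * tensor_norm u" .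
qed

lemma spatial_norm_le:
  fixes N :: "'a::complex_star_algebra \<Rightarrow> real" and M :: "'b::complex_star_algebra \<Rightarrow> real"
  assumes "\<And>a. 0 \<le> N a" "\<And>b. 0 \<le> M b" "0 \<le> C"
    and "\<And>(\<rho> :: 'a \<Rightarrow> ('a ell2 \<Rightarrow>\<^sub>L 'a ell2)) (\<sigma> :: 'b \<Rightarrow> ('b ell2 \<Rightarrow>\<^sub>L 'b ell2)) u.
      contractive_rep N \<rho> \<Longrightarrow> contractive_rep M \<sigma> \<Longrightarrow>
      tensor_norm (tensor_rep \<rho> \<sigma> t u) \<le> C * tensor_norm u"
  shows "spatial_norm N M t \<le> C"
  unfolding spatial_norm_alt
proof (rule cSup_least)
  show "{tensor_opnorm (tensor_rep \<rho> \<sigma> t) |(\<rho> :: 'a \<Rightarrow> ('a ell2 \<Rightarrow>\<^sub>L 'a ell2)) (\<sigma> :: 'b \<Rightarrow> ('b ell2 \<Rightarrow>\<^sub>L 'b ell2)).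
      contractive_rep N \<rho> \<and> contractive_rep M \<sigma>} \<noteq> {}"
    using contractive_rep_zero[of N] contractive_rep_zero[of M] assms(1,2) by blast
qed (use assms(3,4) in \<open>auto intro!: tensor_opnorm_le\<close>)

lemma spatial_norm_nonneg:
  fixes N :: "'a::complex_star_algebra \<Rightarrow> real" and M :: "'b::complex_star_algebra \<Rightarrow> real"
  assumes "\<And>a. 0 \<le> N a" "\<And>b. 0 \<le> M b"
  shows "0 \<le> spatial_norm N M t"
  using spatial_norm_upper(2)[OF contractive_rep_zero contractive_rep_zero] assms by blast

lemma spatial_norm_triangle:
  fixes N :: "'a::complex_star_algebra \<Rightarrow> real" and M :: "'b::complex_star_algebra \<Rightarrow> real"
  assumes "\<And>a. 0 \<le> N a" "\<And>b. 0 \<le> M b"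
  shows "spatial_norm N M (s + t) \<le> spatial_norm N M s + spatial_norm N M t"
proof (rule spatial_norm_le[OF assms])
  show "0 \<le> spatial_norm N M s + spatial_norm N M t"
    by (simp add: spatial_norm_nonneg assms)
  fix \<rho> :: "'a \<Rightarrow> ('a ell2 \<Rightarrow>\<^sub>L 'a ell2)" and \<sigma> :: "'b \<Rightarrow> ('b ell2 \<Rightarrow>\<^sub>L 'b ell2)" and u
  assume r: "contractive_rep N \<rho>" "contractive_rep M \<sigma>"
  then show "tensor_norm (tensor_rep \<rho> \<sigma> (s + t) u) \<le>
      (spatial_norm N M s + spatial_norm N M t) * tensor_norm u"
    using tensor_norm_rep_le_spatial_norm[OF r, of s u] tensor_norm_rep_le_spatial_norm[OF r, of t u]
      tensor_norm_triangle[of "tensor_rep \<rho> \<sigma> s u" "tensor_rep \<rho> \<sigma> t u"]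
    by (simp add: tensor_rep_add contractive_rep_def distrib_right)
qed

lemma spatial_norm_mult:
  fixes N :: "'a::complex_star_algebra \<Rightarrow> real" and M :: "'b::complex_star_algebra \<Rightarrow> real"
  assumes "\<And>a. 0 \<le> N a" "\<And>b. 0 \<le> M b"
  shows "spatial_norm N M (s * t) \<le> spatial_norm N M s * spatial_norm N M t"
proof (rule spatial_norm_le[OF assms])
  show "0 \<le> spatial_norm N M s * spatial_norm N M t"
    by (simp add: spatial_norm_nonneg assms)
  fix \<rho> :: "'a \<Rightarrow> ('a ell2 \<Rightarrow>\<^sub>L 'a ell2)" and \<sigma> :: "'b \<Rightarrow> ('b ell2 \<Rightarrow>\<^sub>L 'b ell2)" and u
  assume r: "contractive_rep N \<rho>" "contractive_rep M \<sigma>"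
  have "tensor_norm (tensor_rep \<rho> \<sigma> (s * t) u)
      \<le> spatial_norm N M s * tensor_norm (tensor_rep \<rho> \<sigma> t u)"
    using r tensor_norm_rep_le_spatial_norm[OF r] by (simp add: tensor_rep_mult contractive_rep_def)
  also have "\<dots> \<le> spatial_norm N M s * (spatial_norm N M t * tensor_norm u)"
    by (intro mult_left_mono tensor_norm_rep_le_spatial_norm r spatial_norm_nonneg assms)
  finally show "tensor_norm (tensor_rep \<rho> \<sigma> (s * t) u) \<le>
      spatial_norm N M s * spatial_norm N M t * tensor_norm u" by (simp add: mult.assoc)
qed

lemma spatial_norm_scale_le:
  fixes N :: "'a::complex_star_algebra \<Rightarrow> real" and M :: "'b::complex_star_algebra \<Rightarrow> real"
  assumes "\<And>a. 0 \<le> N a" "\<And>b. 0 \<le> M b"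
  shows "spatial_norm N M (c *\<^sub>C t) \<le> cmod c * spatial_norm N M t"
proof (rule spatial_norm_le[OF assms])
  show "0 \<le> cmod c * spatial_norm N M t"
    by (simp add: spatial_norm_nonneg assms)
  fix \<rho> :: "'a \<Rightarrow> ('a ell2 \<Rightarrow>\<^sub>L 'a ell2)" and \<sigma> :: "'b \<Rightarrow> ('b ell2 \<Rightarrow>\<^sub>L 'b ell2)" and u
  assume r: "contractive_rep N \<rho>" "contractive_rep M \<sigma>"
  then show "tensor_norm (tensor_rep \<rho> \<sigma> (c *\<^sub>C t) u) \<le> cmod c * spatial_norm N M t * tensor_norm u"
    using tensor_norm_rep_le_spatial_norm[OF r, of t u]
    by (simp add: contractive_rep_def tensor_rep_scale tensor_norm_scale mult.assoc mult_left_mono)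
qed

text \<open>
  \<open>\<parallel>T* u\<parallel>\<^sup>2 = \<langle>u, T T* u\<rangle> \<le> \<parallel>u\<parallel> \<parallel>T\<parallel> \<parallel>T* u\<parallel>\<close>, and the factor \<open>\<parallel>T* u\<parallel>\<close> cancels.
\<close>

lemma spatial_norm_star_le:
  fixes N :: "'a::complex_star_algebra \<Rightarrow> real" and M :: "'b::complex_star_algebra \<Rightarrow> real"
  assumes "\<And>a. 0 \<le> N a" "\<And>b. 0 \<le> M b"
  shows "spatial_norm N M (star t) \<le> spatial_norm N M t"
proof (rule spatial_norm_le[OF assms spatial_norm_nonneg[OF assms]])
  fix \<rho> :: "'a \<Rightarrow> ('a ell2 \<Rightarrow>\<^sub>L 'a ell2)" and \<sigma> :: "'b \<Rightarrow> ('b ell2 \<Rightarrow>\<^sub>L 'b ell2)" and u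
  assume r: "contractive_rep N \<rho>" "contractive_rep M \<sigma>"
  let ?T = "tensor_rep \<rho> \<sigma>"
  define w where "w = ?T (star t) u"
  have "(tensor_norm w)\<^sup>2 = Re (tensor_cinner u (?T t w))"
    using r by (simp add: w_def tensor_norm_square tensor_rep_star contractive_rep_def)
  also have "\<dots> \<le> tensor_norm u * tensor_norm (?T t w)"
    using complex_Re_le_cmod tensor_cinner_cauchy_schwarz by (rule order_trans)
  also have "\<dots> \<le> tensor_norm u * (spatial_norm N M t * tensor_norm w)"
    by (intro mult_left_mono tensor_norm_rep_le_spatial_norm r tensor_norm_ge_0)
  finally have *: "tensor_norm w * tensor_norm w \<le> (spatial_norm N M t * tensor_norm u) * tensor_norm w"
    by (simp add: power2_eq_square ac_simps)
  show "tensor_norm (?T (star t) u) \<le> spatial_norm N M t * tensor_norm u"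
  proof (cases "tensor_norm w = 0")
    case True
    then show ?thesis by (simp add: w_def spatial_norm_nonneg assms tensor_norm_ge_0)
  next
    case False
    then have "0 < tensor_norm w" using tensor_norm_ge_0[of w] by simp
    with * show ?thesis unfolding w_def[symmetric] by (rule mult_right_le_imp_le)
  qed
qed

section \<open>Completions in a seminorm\<close>

lemma uminus_eq_scaleC: "- x = (- 1) *\<^sub>C x" for x :: "'a::complex_vector"
  by (simp add: cvec.scale_minus_left scaleC_one)

lemma star_minus: "star (a - b) = star a - star b"
  using star_add[of "a - b" b] by (simp add: algebra_simps)

text \<open>
  What a seminorm must satisfy for its Cauchy sequences modulo null sequences to form a *-algebra.
  Both the C*-norms on an algebra and the spatial norm are of this kind.
\<close>

locale star_seminorm =
  fixes N :: "'a::complex_star_algebra \<Rightarrow> real"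
  assumes nonneg: "0 \<le> N a"
    and triangle: "N (a + b) \<le> N a + N b"
    and scale_le: "N (c *\<^sub>C a) \<le> cmod c * N a"
    and submult: "N (a * b) \<le> N a * N b"
    and star_le: "N (star a) \<le> N a"
begin

lemma zero: "N 0 = 0"
  using scale_le[of 0 0] nonneg[of 0] by simp

lemma minus_commute: "N (a - b) = N (b - a)"
proof -
  have *: "N (a - b) \<le> N (b - a)" for a b
    using scale_le[of "- 1" "b - a"] by (simp flip: uminus_eq_scaleC)
  show ?thesis by (intro antisym *)
qed

lemma triangle_minus: "N (a - b) \<le> N a + N b"
  using triangle[of a "- b"] scale_le[of "- 1" b] by (simp flip: uminus_eq_scaleC)

lemma dist_triangle: "N (a - c) \<le> N (a - b) + N (b - c)"
  using triangle[of "a - b" "b - c"] by simp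

text \<open>
  The next lemmas are stated for arbitrary filters, because they serve two purposes: along
  \<^term>\<open>sequentially\<close> they say that the operations on sequences respect equality modulo null
  sequences, and along the product of \<^term>\<open>sequentially\<close> with itself that they preserve Cauchy
  sequences.
\<close>

lemma null_comparison:
  assumes "(g \<longlongrightarrow> 0) F" "eventually (\<lambda>p. N (X p) \<le> g p) F"
  shows "((\<lambda>p. N (X p)) \<longlongrightarrow> 0) F"
  using assms by (intro Lim_null_comparison[of "\<lambda>p. N (X p)" g]) (simp_all add: nonneg)

lemma null_add:
  assumes "((\<lambda>p. N (X p - X' p)) \<longlongrightarrow> 0) F" "((\<lambda>p. N (Y p - Y' p)) \<longlongrightarrow> 0) F"
  shows "((\<lambda>p. N ((X p + Y p) - (X' p + Y' p))) \<longlongrightarrow> 0) F"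
proof (rule null_comparison[OF tendsto_add_zero[OF assms]], intro always_eventually allI)
  show "N (X p + Y p - (X' p + Y' p)) \<le> N (X p - X' p) + N (Y p - Y' p)" for p
    using triangle[of "X p - X' p" "Y p - Y' p"] by (simp add: algebra_simps)
qed

lemma null_scale:
  assumes "((\<lambda>p. N (X p - X' p)) \<longlongrightarrow> 0) F"
  shows "((\<lambda>p. N (c *\<^sub>C X p - c *\<^sub>C X' p)) \<longlongrightarrow> 0) F"
  by (rule null_comparison[OF tendsto_mult_right_zero[OF assms, of "cmod c"]])
    (simp add: scale_le flip: cvec.scale_right_diff_distrib)

lemma null_star:
  assumes "((\<lambda>p. N (X p - X' p)) \<longlongrightarrow> 0) F"
  shows "((\<lambda>p. N (star (X p) - star (X' p))) \<longlongrightarrow> 0) F"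
  by (rule null_comparison[OF assms]) (simp add: star_le flip: star_minus)

lemma null_mult:
  assumes "((\<lambda>p. N (X p - X' p)) \<longlongrightarrow> 0) F" "((\<lambda>p. N (Y p - Y' p)) \<longlongrightarrow> 0) F"
    and "eventually (\<lambda>p. N (X' p) \<le> C) F" "eventually (\<lambda>p. N (Y p) \<le> B) F"
  shows "((\<lambda>p. N (X p * Y p - X' p * Y' p)) \<longlongrightarrow> 0) F"
proof (rule null_comparison)
  show "((\<lambda>p. N (X p - X' p) * B + C * N (Y p - Y' p)) \<longlongrightarrow> 0) F"
    by (intro tendsto_add_zero tendsto_mult_left_zero tendsto_mult_right_zero assms)
  show "eventually (\<lambda>p. N (X p * Y p - X' p * Y' p) \<le> N (X p - X' p) * B + C * N (Y p - Y' p)) F"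
    using assms(3,4)
  proof eventually_elim
    case (elim p)
    have "N (X p * Y p - X' p * Y' p) \<le> N ((X p - X' p) * Y p) + N (X' p * (Y p - Y' p))"
      using triangle[of "(X p - X' p) * Y p" "X' p * (Y p - Y' p)"] by (simp add: algebra_simps)
    also have "\<dots> \<le> N (X p - X' p) * N (Y p) + N (X' p) * N (Y p - Y' p)"
      by (intro add_mono submult)
    also have "\<dots> \<le> N (X p - X' p) * B + C * N (Y p - Y' p)"
      by (intro add_mono mult_mono elim nonneg order_trans[OF nonneg elim(1)] order_refl)
    finally show ?case .
  qed
qed

lemma cauchy_seqs_iff:
  "x \<in> cauchy_seqs N \<longleftrightarrow>
    ((\<lambda>p. N (x (fst p) - x (snd p))) \<longlongrightarrow> 0) (sequentially \<times>\<^sub>F sequentially)"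
  by (simp add: cauchy_seqs_def tendsto_iff eventually_prod_sequentially nonneg) blast

lemma cauchy_seqs_const: "(\<lambda>_. a) \<in> cauchy_seqs N"
  by (simp add: cauchy_seqs_iff zero)

lemma cauchy_seqs_bounded:
  assumes "x \<in> cauchy_seqs N"
  obtains B where "eventually (\<lambda>n. N (x n) \<le> B) sequentially"
proof -
  have "\<exists>M. \<forall>m\<ge>M. \<forall>n\<ge>M. N (x m - x n) < 1"
    using assms by (simp add: cauchy_seqs_def)
  then obtain M where M: "\<And>n. n \<ge> M \<Longrightarrow> N (x n - x M) < 1" by blast
  have "N (x n) \<le> 1 + N (x M)" if "n \<ge> M" for n
    using M[OF that] triangle[of "x n - x M" "x M"] by simp
  then show thesis by (intro that[of "1 + N (x M)"]) (auto simp: eventually_sequentially)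
qed

lemma cauchy_seqs_add: "x \<in> cauchy_seqs N \<Longrightarrow> y \<in> cauchy_seqs N \<Longrightarrow> (\<lambda>n. x n + y n) \<in> cauchy_seqs N"
  unfolding cauchy_seqs_iff by (rule null_add)

lemma cauchy_seqs_scale: "x \<in> cauchy_seqs N \<Longrightarrow> (\<lambda>n. c *\<^sub>C x n) \<in> cauchy_seqs N"
  unfolding cauchy_seqs_iff by (rule null_scale)

lemma cauchy_seqs_star: "x \<in> cauchy_seqs N \<Longrightarrow> (\<lambda>n. star (x n)) \<in> cauchy_seqs N"
  unfolding cauchy_seqs_iff by (rule null_star)

lemma cauchy_seqs_mult:
  assumes "x \<in> cauchy_seqs N" "y \<in> cauchy_seqs N"
  shows "(\<lambda>n. x n * y n) \<in> cauchy_seqs N"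
proof -
  obtain B C where "eventually (\<lambda>n. N (x n) \<le> C) sequentially" "eventually (\<lambda>n. N (y n) \<le> B) sequentially"
    using assms cauchy_seqs_bounded by metis
  then have "eventually (\<lambda>p. N (x (snd p)) \<le> C) (sequentially \<times>\<^sub>F sequentially)"
      "eventually (\<lambda>p. N (y (fst p)) \<le> B) (sequentially \<times>\<^sub>F sequentially)"
    by (auto intro: eventually_compose_filterlim filterlim_fst filterlim_snd)
  then show ?thesis using assms unfolding cauchy_seqs_iff by (intro null_mult)
qed

lemma null_relI:
  "x \<in> cauchy_seqs N \<Longrightarrow> y \<in> cauchy_seqs N \<Longrightarrow> (\<lambda>n. N (x n - y n)) \<longlonglongrightarrow> 0 \<Longrightarrow> (x, y) \<in> null_rel N"
  by (simp add: null_rel_def)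

lemma null_relD:
  assumes "(x, y) \<in> null_rel N"
  shows "x \<in> cauchy_seqs N" "y \<in> cauchy_seqs N" "(\<lambda>n. N (x n - y n)) \<longlonglongrightarrow> 0"
  using assms by (auto simp: null_rel_def)

lemma equiv_null_rel: "equiv (cauchy_seqs N) (null_rel N)"
proof (rule equivI)
  show "null_rel N \<subseteq> cauchy_seqs N \<times> cauchy_seqs N"
    by (auto simp: null_rel_def)
  show "refl_on (cauchy_seqs N) (null_rel N)"
    by (auto intro!: refl_onI simp: null_rel_def zero)
  show "sym (null_rel N)"
    by (auto intro!: symI simp: null_rel_def minus_commute)
  show "trans (null_rel N)"
  proof (rule transI)
    fix x y z assume *: "(x, y) \<in> null_rel N" "(y, z) \<in> null_rel N"
    show "(x, z) \<in> null_rel N"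
      by (rule null_relI[OF null_relD(1)[OF *(1)] null_relD(2)[OF *(2)]],
          rule null_comparison[OF tendsto_add_zero[OF null_relD(3)[OF *(1)] null_relD(3)[OF *(2)]]])
        (simp add: dist_triangle)
  qed
qed

lemma null_class_eqI: "(x, y) \<in> null_rel N \<Longrightarrow> null_rel N `` {x} = null_rel N `` {y}"
  by (rule equiv_class_eq[OF equiv_null_rel])

lemma null_class_eqD:
  "null_rel N `` {x} = null_rel N `` {y} \<Longrightarrow> y \<in> cauchy_seqs N \<Longrightarrow> (x, y) \<in> null_rel N"
  by (rule eq_equiv_class[OF _ equiv_null_rel])

lemma null_class_in_completion: "x \<in> cauchy_seqs N \<Longrightarrow> null_rel N `` {x} \<in> completion N"
  unfolding completion_def by (rule quotientI)

lemma completionE: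
  assumes "X \<in> completion N"
  obtains x where "x \<in> cauchy_seqs N" "X = null_rel N `` {x}"
  using assms unfolding completion_def by (rule quotientE)

lemma completion_add_class:
  assumes "x \<in> cauchy_seqs N" "y \<in> cauchy_seqs N"
  shows "completion_add N (null_rel N `` {x}) (null_rel N `` {y}) = null_rel N `` {\<lambda>n. x n + y n}"
  unfolding completion_add_def
  by (rule UN_equiv_class2[OF equiv_null_rel equiv_null_rel _ assms])
    (auto intro!: congruent2I' null_class_eqI null_relI cauchy_seqs_add null_add dest: null_relD)

lemma completion_mult_class:
  assumes "x \<in> cauchy_seqs N" "y \<in> cauchy_seqs N"
  shows "completion_mult N (null_rel N `` {x}) (null_rel N `` {y}) = null_rel N `` {\<lambda>n. x n * y n}"
  unfolding completion_mult_def
proof (rule UN_equiv_class2[OF equiv_null_rel equiv_null_rel _ assms], rule congruent2I', rule null_class_eqI)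
  fix x x' y y' assume "(x, x') \<in> null_rel N" "(y, y') \<in> null_rel N"
  note * = null_relD[OF this(1)] null_relD[OF this(2)]
  obtain B C where "eventually (\<lambda>n. N (x' n) \<le> C) sequentially" "eventually (\<lambda>n. N (y n) \<le> B) sequentially"
    using * cauchy_seqs_bounded by metis
  with * show "(\<lambda>n. x n * y n, \<lambda>n. x' n * y' n) \<in> null_rel N"
    by (intro null_relI cauchy_seqs_mult null_mult)
qed

lemma completion_scale_class:
  assumes "x \<in> cauchy_seqs N"
  shows "completion_scale N c (null_rel N `` {x}) = null_rel N `` {\<lambda>n. c *\<^sub>C x n}"
  unfolding completion_scale_def
  by (rule UN_equiv_class[OF equiv_null_rel _ assms])
    (auto intro!: congruentI null_class_eqI null_relI cauchy_seqs_scale null_scale dest: null_relD)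

lemma completion_star_class:
  assumes "x \<in> cauchy_seqs N"
  shows "completion_star N (null_rel N `` {x}) = null_rel N `` {\<lambda>n. star (x n)}"
  unfolding completion_star_def
  by (rule UN_equiv_class[OF equiv_null_rel _ assms])
    (auto intro!: congruentI null_class_eqI null_relI cauchy_seqs_star null_star dest: null_relD)

lemmas completion_class = completion_add_class completion_mult_class completion_scale_class
  completion_star_class

end

text \<open>
  Boundedness by any multiple of the norm is enough for a *-homomorphism to extend: it preserves
  Cauchy sequences and null sequences.
\<close>

lemma completion_star_hom_extension:
  fixes N :: "'a::complex_star_algebra \<Rightarrow> real" and M :: "'b::complex_star_algebra \<Rightarrow> real"
  assumes N: "star_seminorm N" and M: "star_seminorm M"
    and D: "clinear D" "\<And>a b. D (a * b) = D a * D b" "\<And>a. D (star a) = star (D a)"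
    and bounded: "\<And>a. M (D a) \<le> C * N a"
  shows "\<exists>\<Phi>. completion_star_hom N M \<Phi> \<and> (\<forall>a. \<Phi> (to_completion N a) = to_completion M (D a))"
proof -
  interpret N: star_seminorm N by (rule N)
  interpret M: star_seminorm M by (rule M)
  define \<Phi> where "\<Phi> X = (\<Union>x\<in>X. null_rel M `` {\<lambda>n. D (x n)})" for X
  have null: "((\<lambda>p. M (D (X p) - D (X' p))) \<longlongrightarrow> 0) F" if "((\<lambda>p. N (X p - X' p)) \<longlongrightarrow> 0) F"
    for X X' :: "'p \<Rightarrow> 'a" and F
    by (rule M.null_comparison[OF tendsto_mult_right_zero[OF that, of C]])
      (simp add: bounded flip: clinear_diff[OF D(1)])
  have cauchy: "(\<lambda>n. D (x n)) \<in> cauchy_seqs M" if "x \<in> cauchy_seqs N" for x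
    using that unfolding N.cauchy_seqs_iff M.cauchy_seqs_iff by (rule null)
  have \<Phi>: "\<Phi> (null_rel N `` {x}) = null_rel M `` {\<lambda>n. D (x n)}" if "x \<in> cauchy_seqs N" for x
    unfolding \<Phi>_def
    by (rule UN_equiv_class[OF N.equiv_null_rel _ that])
      (auto intro!: congruentI M.null_class_eqI M.null_relI cauchy null dest: N.null_relD)
  have "completion_star_hom N M \<Phi>"
    unfolding completion_star_hom_def
  proof (intro conjI ballI allI subsetI)
    show "Y \<in> completion M" if Y: "Y \<in> \<Phi> ` completion N" for Y
      using Y by (auto elim!: N.completionE simp: \<Phi> cauchy intro!: M.null_class_in_completion)
  next
    fix X Y assume "X \<in> completion N" "Y \<in> completion N"
    then obtain x y where xy: "x \<in> cauchy_seqs N" "X = null_rel N `` {x}"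
      "y \<in> cauchy_seqs N" "Y = null_rel N `` {y}" by (metis N.completionE)
    then show "\<Phi> (completion_add N X Y) = completion_add M (\<Phi> X) (\<Phi> Y)"
      by (simp add: \<Phi> N.completion_class M.completion_class cauchy N.cauchy_seqs_add clinear_add[OF D(1)])
    show "\<Phi> (completion_mult N X Y) = completion_mult M (\<Phi> X) (\<Phi> Y)"
      using xy by (simp add: \<Phi> N.completion_class M.completion_class cauchy N.cauchy_seqs_mult D(2))
  next
    fix X assume "X \<in> completion N"
    then obtain x where x: "x \<in> cauchy_seqs N" "X = null_rel N `` {x}" by (rule N.completionE)
    then show "\<Phi> (completion_scale N c X) = completion_scale M c (\<Phi> X)" for c
      by (simp add: \<Phi> N.completion_class M.completion_class cauchy N.cauchy_seqs_scale clinear_scale[OF D(1)])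
    show "\<Phi> (completion_star N X) = completion_star M (\<Phi> X)"
      using x by (simp add: \<Phi> N.completion_class M.completion_class cauchy N.cauchy_seqs_star D(3))
  qed
  then show ?thesis
    by (intro exI[of _ \<Phi>]) (simp add: to_completion_def \<Phi> N.cauchy_seqs_const)
qed

section \<open>Square roots and positivity\<close>

text \<open>
  The completion contains a selfadjoint square root of \<open>1 - h\<close>. Writing it as \<open>1 - y\<close> turns the equation
  into the fixed point problem \<open>y = (h + y\<^sup>2) / 2\<close>, and on the ball of radius \<open>c = N h < 1\<close> the right hand
  side is a contraction with factor \<open>c\<close>. Iterating from \<open>0\<close> stays inside the algebra itself and
  keeps all iterates selfadjoint.
\<close>

lemma (in star_seminorm) cauchy_sqrt:
  assumes "star h = h" "N h < 1"
  obtains k where "k \<in> cauchy_seqs N" "\<And>n. star (k n) = k n"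
    "(\<lambda>n. N (k n * k n - (1 - h))) \<longlonglongrightarrow> 0"
proof -
  define c where "c = N h"
  have c: "0 \<le> c" "c < 1" using assms nonneg by (auto simp: c_def)
  define y where "y = rec_nat 0 (\<lambda>_ z. (1 / 2) *\<^sub>C (h + z * z))"
  have y0: "y 0 = 0" and ySuc: "y (Suc n) = (1 / 2) *\<^sub>C (h + y n * y n)" for n
    by (simp_all add: y_def)
  have star_y: "star (y n) = y n" for n
  proof (induction n)
    case 0
    show ?case using star_scaleC[of 0 0] by (simp add: y0)
  qed (simp add: ySuc star_scaleC star_add star_mult assms(1))
  have bound: "N (y n) \<le> c" for n
  proof (induction n)
    case 0
    then show ?case by (simp add: y0 zero c)
  next
    case (Suc n)
    have "N (y (Suc n)) \<le> 1 / 2 * N (h + y n * y n)"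
      unfolding ySuc using scale_le[of "1 / 2"] by simp
    also have "\<dots> \<le> 1 / 2 * (c + c * c)"
      by (intro mult_left_mono order_trans[OF triangle] add_mono order_trans[OF submult] mult_mono Suc nonneg c)
        (simp_all add: c_def)
    also have "\<dots> \<le> c" using mult_left_le[of c c] c by simp
    finally show ?case .
  qed
  have step: "N (y (m + n) - y n) \<le> c ^ n" for m n
  proof (induction n)
    case 0
    show ?case using bound[of m] c by (simp add: y0)
  next
    case (Suc n)
    let ?d = "y (m + n) - y n"
    \<comment> \<open>\<open>a\<^sup>2 - b\<^sup>2 = a (a - b) + (a - b) b\<close> needs no commutativity.\<close>
    have "y (m + Suc n) - y (Suc n) = (1 / 2) *\<^sub>C (y (m + n) * ?d + ?d * y n)"
      by (simp add: ySuc algebra_simps flip: cvec.scale_right_diff_distrib)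
    then have "N (y (m + Suc n) - y (Suc n)) \<le> 1 / 2 * N (y (m + n) * ?d + ?d * y n)"
      using scale_le[of "1 / 2"] by simp
    also have "\<dots> \<le> 1 / 2 * (c * c ^ n + c ^ n * c)"
      by (intro mult_left_mono order_trans[OF triangle] add_mono order_trans[OF submult] mult_mono
          bound Suc.IH nonneg c zero_le_power) simp_all
    finally show ?case by simp
  qed
  have pow: "(\<lambda>n. c ^ n) \<longlonglongrightarrow> 0" using c by (intro LIMSEQ_realpow_zero)
  define k where "k n = 1 - y n" for n
  show thesis
  proof
    show "k \<in> cauchy_seqs N"
      unfolding cauchy_seqs_def
    proof (intro CollectI allI impI)
      fix e :: real assume "0 < e"
      then obtain M where M: "c ^ M < e / 2"
        using order_tendstoD(2)[OF pow, of "e / 2"] by (auto simp: eventually_sequentially)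
      have "N (k m - k M) < e / 2" if "M \<le> m" for m
        using step[of "m - M" M] that M by (simp add: k_def minus_commute)
      then have "N (k m - k n) < e / 2 + e / 2" if "M \<le> m" "M \<le> n" for m n
        using that dist_triangle[of "k m" "k n" "k M"] minus_commute[of "k M" "k n"]
        by (smt (verit))
      then show "\<exists>M. \<forall>m\<ge>M. \<forall>n\<ge>M. N (k m - k n) < e" by auto
    qed
    show "star (k n) = k n" for n by (simp add: k_def star_minus star_y)
    show "(\<lambda>n. N (k n * k n - (1 - h))) \<longlonglongrightarrow> 0"
    proof (rule null_comparison[OF tendsto_mult_right_zero[OF pow, of 2]], intro always_eventually allI)
      fix n
      \<comment> \<open>\<open>(1 - y n)\<^sup>2 - (1 - h) = y n\<^sup>2 + h - 2 y n = 2 (y (n + 1) - y n)\<close>\<close>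
      have "2 *\<^sub>C y (Suc n) = h + y n * y n"
        by (simp add: ySuc scaleC_scaleC scaleC_one)
      moreover have "2 *\<^sub>C y n = y n + y n"
        using scaleC_add_left[of 1 1 "y n"] by (simp add: scaleC_one)
      ultimately have "k n * k n - (1 - h) = 2 *\<^sub>C (y (1 + n) - y n)"
        by (simp add: k_def cvec.scale_right_diff_distrib algebra_simps)
      then show "N (k n * k n - (1 - h)) \<le> 2 * c ^ n"
        using scale_le[of 2 "y (1 + n) - y n"] step[of 1 n] by simp
    qed
  qed
qed

text \<open>
  A *-homomorphism of completions maps the selfadjoint square root of \<open>1 - h\<close> to a selfadjoint element,
  so the image of \<open>1 - h\<close> is of the form \<open>l* l\<close> in the completion. This purely algebraic use of square
  roots takes the place of the spectral radius in the proof that *-homomorphisms are contractive.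
\<close>

lemma completion_star_hom_positive:
  fixes N :: "'a::complex_star_algebra \<Rightarrow> real" and M :: "'b::complex_star_algebra \<Rightarrow> real"
  assumes N: "star_seminorm N" and M: "star_seminorm M"
    and hom: "completion_star_hom N M \<Phi>"
    and ext: "\<And>a. \<Phi> (to_completion N a) = to_completion M (D a)"
    and h: "star h = h" "N h < 1"
  obtains l where "(\<lambda>n. M (star (l n) * l n - D (1 - h))) \<longlonglongrightarrow> 0"
proof -
  interpret N: star_seminorm N by (rule N)
  interpret M: star_seminorm M by (rule M)
  obtain k where k: "k \<in> cauchy_seqs N" "\<And>n. star (k n) = k n"
    "(\<lambda>n. N (k n * k n - (1 - h))) \<longlonglongrightarrow> 0"
    using N.cauchy_sqrt[OF h] by metis
  define K where "K = null_rel N `` {k}"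
  have K: "K \<in> completion N" unfolding K_def by (rule N.null_class_in_completion[OF k(1)])
  then have "\<Phi> K \<in> completion M"
    using hom unfolding completion_star_hom_def by blast
  then obtain l where l: "l \<in> cauchy_seqs M" "\<Phi> K = null_rel M `` {l}"
    by (rule M.completionE)
  have "completion_star N K = K"
    unfolding K_def N.completion_star_class[OF k(1)] k(2) ..
  then have "\<Phi> K = completion_star M (\<Phi> K)"
    using hom K unfolding completion_star_hom_def by metis
  then have star_l: "\<Phi> K = null_rel M `` {\<lambda>n. star (l n)}"
    using l M.completion_star_class by simp
  have "completion_mult N K K = to_completion N (1 - h)"
    unfolding K_def N.completion_mult_class[OF k(1) k(1)] to_completion_def
    by (intro N.null_class_eqI N.null_relI N.cauchy_seqs_mult N.cauchy_seqs_const k)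
  then have "to_completion M (D (1 - h)) = completion_mult M (\<Phi> K) (\<Phi> K)"
    using hom K unfolding completion_star_hom_def by (metis ext)
  also have "\<dots> = null_rel M `` {\<lambda>n. star (l n) * l n}"
    by (subst (1) star_l, subst l(2)) (rule M.completion_mult_class[OF M.cauchy_seqs_star[OF l(1)] l(1)])
  finally have "null_rel M `` {\<lambda>n. star (l n) * l n} = null_rel M `` {\<lambda>_. D (1 - h)}"
    by (simp add: to_completion_def)
  then have "(\<lambda>n. star (l n) * l n, \<lambda>_. D (1 - h)) \<in> null_rel M"
    using M.cauchy_seqs_const by (rule M.null_class_eqD)
  then show thesis by (intro that M.null_relD(3))
qed

section \<open>The comultiplication under contractive representations\<close>

lemma star_seminorm_spatial_norm:
  assumes N: "\<And>a. 0 \<le> N a" and M: "\<And>b. 0 \<le> M b"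
  shows "star_seminorm (spatial_norm N M)"
  by unfold_locales
    (rule spatial_norm_nonneg spatial_norm_triangle spatial_norm_scale_le spatial_norm_mult
      spatial_norm_star_le N M)+

lemma cstar_normD:
  assumes "cstar_norm N"
  shows "0 \<le> N a" "N a = 0 \<longleftrightarrow> a = 0" "N (a + b) \<le> N a + N b" "N (c *\<^sub>C a) = cmod c * N a"
    "N (a * b) \<le> N a * N b" "N (star a * a) = (N a)\<^sup>2"
  using assms unfolding cstar_norm_def by auto

lemma star_seminorm_cstar_norm:
  assumes "cstar_norm N"
  shows "star_seminorm N"
proof
  note N = cstar_normD[OF assms]
  show "0 \<le> N a" "N (a + b) \<le> N a + N b" "N (c *\<^sub>C a) \<le> cmod c * N a" "N (a * b) \<le> N a * N b"
    for a b c by (simp_all add: N)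
  have *: "N a \<le> N (star a)" for a
  proof (cases "N a = 0")
    case True
    then show ?thesis using N(1)[of "star a"] by linarith
  next
    case False
    then have "0 < N a" using N(1)[of a] by simp
    moreover have "N a * N a \<le> N (star a) * N a"
      using N(5)[of "star a" a] N(6)[of a] by (simp add: power2_eq_square)
    ultimately show ?thesis by simp
  qed
  show "N (star a) \<le> N a" for a using *[of "star a"] by (simp add: star_star)
qed

lemma cstar_norm_one_le:
  assumes "cstar_norm N"
  shows "N 1 \<le> 1"
proof (rule ccontr)
  assume "\<not> N 1 \<le> 1"
  then have "1 * N 1 < N 1 * N 1" by (intro mult_strict_right_mono) auto
  then show False using cstar_normD(6)[OF assms, of 1] by (auto simp: power2_eq_square)
qed

lemma one_tensor_tens: "1 = 1 \<otimes> 1"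
  by transfer (rule tensor_rel_refl)

text \<open>
  The extension of \<open>\<Delta>\<close> to the completions, which is not assumed to be continuous, is automatically
  contractive. For \<open>N a < 1\<close> the image of \<open>1 - a* a\<close> is approximated by elements \<open>l* l\<close>, hence positive
  in every representation \<open>T = \<rho> \<otimes> \<sigma>\<close>, and
  \<open>\<parallel>T (\<Delta> a) u\<parallel>\<^sup>2 = \<langle>u, T 1 u\<rangle> - \<langle>u, T (\<Delta> (1 - a* a)) u\<rangle> \<le> \<parallel>u\<parallel>\<^sup>2\<close>.
  The general case follows by scaling.
\<close>

lemma quantum_group_norm_comult_bound:
  fixes \<Delta> :: "'a::complex_star_algebra \<Rightarrow> ('a, 'a) tensor"
    and \<rho> \<sigma> :: "'a \<Rightarrow> ('a ell2 \<Rightarrow>\<^sub>L 'a ell2)"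
  assumes "quantum_group_norm \<Delta> N"
    and D: "clinear \<Delta>" "\<And>a b. \<Delta> (a * b) = \<Delta> a * \<Delta> b" "\<And>a. \<Delta> (star a) = star (\<Delta> a)" "\<Delta> 1 = 1"
    and r: "contractive_rep N \<rho>" "contractive_rep N \<sigma>"
  shows "tensor_norm (tensor_rep \<rho> \<sigma> (\<Delta> a) u) \<le> N a * tensor_norm u"
proof -
  let ?T = "tensor_rep \<rho> \<sigma>" and ?M = "spatial_norm N N"
  from assms(1) obtain \<Phi> where cstar: "cstar_norm N"
    and hom: "completion_star_hom N ?M \<Phi>"
    and ext: "\<And>a. \<Phi> (to_completion N a) = to_completion ?M (\<Delta> a)"
    unfolding quantum_group_norm_def by blast
  note N = cstar_normD[OF cstar]
  have reps: "star_rep \<rho>" "star_rep \<sigma>"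
    and le: "\<And>a. norm (\<rho> a) \<le> N a" "\<And>a. norm (\<sigma> a) \<le> N a"
    using r by (auto simp: contractive_rep_def)
  note T = tensor_rep_mult[OF reps] tensor_rep_add[OF reps] clinear_diff[OF clinear_tensor_rep_left[OF reps]]
  have adj: "tensor_cinner u (?T (star t * t) u) = tensor_cinner (?T t u) (?T t u)" for t u
    using tensor_rep_star[OF reps, of "star t" u "?T t u"] by (simp add: T star_star)
  have unit_ball: "tensor_norm (?T (\<Delta> a) u) \<le> tensor_norm u" if a: "N a < 1" for a u
  proof -
    define h where "h = star a * a"
    have h: "star h = h" by (simp add: h_def star_mult star_star)
    have "N h < 1"
      using a N(1)[of a] by (simp add: h_def N power_less_one_iff)
    then obtain l where l: "(\<lambda>n. ?M (star (l n) * l n - \<Delta> (1 - h))) \<longlonglongrightarrow> 0"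
      by (rule completion_star_hom_positive[OF star_seminorm_cstar_norm[OF cstar]
            star_seminorm_spatial_norm[OF N(1) N(1)] hom ext h])
    have "- (tensor_norm u * (?M (star (l n) * l n - \<Delta> (1 - h)) * tensor_norm u))
        \<le> Re (tensor_cinner u (?T (\<Delta> (1 - h)) u))" for n
    proof -
      let ?d = "star (l n) * l n - \<Delta> (1 - h)"
      have "?T (star (l n) * l n) u = ?T ?d u + ?T (\<Delta> (1 - h)) u"
        by (simp flip: T(2))
      then have "tensor_cinner (?T (l n) u) (?T (l n) u) =
          tensor_cinner u (?T ?d u) + tensor_cinner u (?T (\<Delta> (1 - h)) u)"
        by (simp add: tensor_cinner_add_right flip: adj)
      then have "0 \<le> Re (tensor_cinner u (?T ?d u)) + Re (tensor_cinner u (?T (\<Delta> (1 - h)) u))"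
        using tensor_cinner.pos[of "?T (l n) u"] by simp
      moreover have "Re (tensor_cinner u (?T ?d u)) \<le> tensor_norm u * tensor_norm (?T ?d u)"
        using complex_Re_le_cmod tensor_cinner_cauchy_schwarz by (rule order_trans)
      moreover have "tensor_norm u * tensor_norm (?T ?d u) \<le> tensor_norm u * (?M ?d * tensor_norm u)"
        by (intro mult_left_mono tensor_norm_rep_le_spatial_norm r tensor_norm_ge_0)
      ultimately show ?thesis by linarith
    qed
    moreover have "(\<lambda>n. - (tensor_norm u * (?M (star (l n) * l n - \<Delta> (1 - h)) * tensor_norm u))) \<longlonglongrightarrow> 0"
      using tendsto_minus[OF tendsto_mult_right_zero[OF tendsto_mult_left_zero[OF l]]] by simp
    ultimately have "0 \<le> Re (tensor_cinner u (?T (\<Delta> (1 - h)) u))"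
      by (intro LIMSEQ_le_const2[of _ 0]) auto
    also have "\<Delta> (1 - h) = 1 - star (\<Delta> a) * \<Delta> a"
      by (simp add: h_def clinear_diff[OF D(1)] D(2-4))
    also have "Re (tensor_cinner u (?T (1 - star (\<Delta> a) * \<Delta> a) u)) =
        Re (tensor_cinner u (?T 1 u)) - (tensor_norm (?T (\<Delta> a) u))\<^sup>2"
    proof -
      have "?T 1 u = ?T (1 - star (\<Delta> a) * \<Delta> a) u + ?T (star (\<Delta> a) * \<Delta> a) u"
        by (simp flip: T(2))
      then show ?thesis
        unfolding tensor_norm_square adj[symmetric] by (simp add: tensor_cinner_add_right)
    qed
    finally have "(tensor_norm (?T (\<Delta> a) u))\<^sup>2 \<le> Re (tensor_cinner u (?T 1 u))" by simp
    also have "\<dots> \<le> tensor_norm u * tensor_norm (?T 1 u)"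
      using complex_Re_le_cmod tensor_cinner_cauchy_schwarz by (rule order_trans)
    also have "\<dots> \<le> tensor_norm u * (1 * 1 * tensor_norm u)"
      unfolding one_tensor_tens tensor_rep_tens[OF reps]
      by (intro mult_left_mono order_trans[OF tensor_norm_map] mult_right_mono mult_mono star_repD(1) reps
          tensor_norm_ge_0 norm_ge_zero order_trans[OF le(1) cstar_norm_one_le[OF cstar]]
          order_trans[OF le(2) cstar_norm_one_le[OF cstar]]) simp_all
    finally have "(tensor_norm (?T (\<Delta> a) u))\<^sup>2 \<le> (tensor_norm u)\<^sup>2"
      by (simp add: power2_eq_square)
    then show ?thesis by (rule power2_le_imp_le[OF _ tensor_norm_ge_0])
  qed
  have scaled: "tensor_norm (?T (\<Delta> a) u) \<le> r * tensor_norm u" if "N a < r" for r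
  proof -
    have "0 < r" using that N(1)[of a] by linarith
    then have "N (complex_of_real (1 / r) *\<^sub>C a) < 1"
      using that unfolding N(4) by (simp add: norm_divide)
    from unit_ball[OF this, of u] show ?thesis
      using \<open>0 < r\<close>
      by (simp add: clinear_scale[OF D(1)] tensor_rep_scale[OF reps] tensor_norm_scale norm_divide field_simps)
  qed
  show ?thesis
  proof (cases "tensor_norm u = 0")
    case True
    then show ?thesis using scaled[of "N a + 1"] by simp
  next
    case False
    then have pos: "0 < tensor_norm u" using tensor_norm_ge_0[of u] by simp
    have "tensor_norm (?T (\<Delta> a) u) / tensor_norm u \<le> N a"
    proof (rule dense_ge)
      show "tensor_norm (?T (\<Delta> a) u) / tensor_norm u \<le> r" if "N a < r" for r
        using scaled[OF that] pos by (simp add: pos_divide_le_eq)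
    qed
    then show ?thesis using pos by (simp add: field_simps)
  qed
qed

section \<open>Splitting off a character\<close>

lemma star_rep_compose_projection:
  assumes \<rho>: "star_rep \<rho>" and Q: "clinear (blinfun_apply Q)"
    and idem: "\<And>x. Q (Q x) = Q x" and adj: "\<And>x y. cinner (Q x) y = cinner x (Q y)"
    and comm: "\<And>a x. \<rho> a (Q x) = Q (\<rho> a x)"
  shows "star_rep (\<lambda>a. \<rho> a o\<^sub>L Q)"
  unfolding star_rep_def
proof (intro conjI allI)
  note r = star_repD[OF \<rho>]
  show "clinear (blinfun_apply (\<rho> a o\<^sub>L Q))" for a
    using clinear_compose[OF r(1)[of a] Q] by (simp add: clinear_iff)
  show "\<rho> (a + b) o\<^sub>L Q = (\<rho> a o\<^sub>L Q) + (\<rho> b o\<^sub>L Q)" for a b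
    by (rule blinfun_eqI) (simp add: r(2) blinfun.add_left)
  show "blinfun_apply (\<rho> (c *\<^sub>C a) o\<^sub>L Q) x = c *\<^sub>C blinfun_apply (\<rho> a o\<^sub>L Q) x" for c a x
    by (simp add: r(3))
  show "\<rho> (a * b) o\<^sub>L Q = (\<rho> a o\<^sub>L Q) o\<^sub>L (\<rho> b o\<^sub>L Q)" for a b
    by (rule blinfun_eqI) (simp add: r(4) idem flip: comm)
  show "cinner (blinfun_apply (\<rho> (star a) o\<^sub>L Q) x) y = cinner x (blinfun_apply (\<rho> a o\<^sub>L Q) y)" for a x y
    by (simp add: r(5) adj comm)
qed

text \<open>
  An element \<open>p\<close> with \<open>\<epsilon> p = 1\<close> and \<open>N p < 1\<close> shows that \<open>\<epsilon>\<close> is discontinuous for \<open>N\<close>. Its powers converge in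
  the completion for \<open>max N |\<epsilon>|\<close> to the projection onto the character summand, where \<open>N\<close> vanishes and
  \<open>\<epsilon>\<close> is \<open>1\<close>. In a representation \<open>\<rho>\<close> they converge to a projection \<open>P\<close> that commutes with \<open>\<rho>\<close>; on the range
  of \<open>P\<close> the representation is a multiple of \<open>\<epsilon>\<close>, and on its complement it is contractive for \<open>N\<close>
  alone, because \<open>\<rho> a (1 - P)\<close> is the limit of \<open>\<rho> (a - \<epsilon> a p\<^sup>n)\<close>, where \<open>\<epsilon>\<close> vanishes and \<open>N\<close> is at most
  \<open>N a + |\<epsilon> a| (N p)\<^sup>n\<close>.
\<close>

lemma split_off_character:
  fixes \<rho> :: "'a::complex_star_algebra \<Rightarrow> ('h::chilbert_space \<Rightarrow>\<^sub>L 'h)"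
  assumes cstar: "cstar_norm N"
    and eps: "clinear \<epsilon>" "\<And>a b. \<epsilon> (a * b) = \<epsilon> a * \<epsilon> b" "\<epsilon> 1 = 1"
      "\<And>a. \<epsilon> (star a) = cnj (\<epsilon> a)"
    and contr: "contractive_rep (\<lambda>a. max (N a) (cmod (\<epsilon> a))) \<rho>"
    and p: "\<epsilon> p = 1" "N p < 1"
  obtains P where "clinear (blinfun_apply P)" "norm P \<le> 1"
    "\<forall>a x. blinfun_apply (\<rho> a) (P x) = \<epsilon> a *\<^sub>C P x"
    "star_rep (\<lambda>a. \<rho> a o\<^sub>L P)" "contractive_rep N (\<lambda>a. \<rho> a o\<^sub>L (id_blinfun - P))"
proof -
  interpret N: star_seminorm N by (rule star_seminorm_cstar_norm[OF cstar])
  have \<rho>: "star_rep \<rho>" and le: "\<And>a. norm (\<rho> a) \<le> max (N a) (cmod (\<epsilon> a))"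
    using contr by (auto simp: contractive_rep_def)
  note r = star_repD[OF \<rho>]
  have eps_scale: "\<epsilon> (c *\<^sub>C a) = c * \<epsilon> a" for c a
    using clinear_scale[OF eps(1)] by (simp add: scaleC_complex_def)
  have eps_pow: "\<epsilon> (p ^ n) = 1" for n by (induction n) (simp_all add: eps p)
  have N_pow: "N (p ^ n) \<le> N p ^ n" for n
  proof (induction n)
    case (Suc n)
    have "N (p ^ Suc n) \<le> N p * N (p ^ n)" using N.submult by simp
    also have "\<dots> \<le> N p * N p ^ n" by (intro mult_left_mono Suc N.nonneg)
    finally show ?case by simp
  qed (simp add: cstar_norm_one_le[OF cstar])
  have N_pow0: "(\<lambda>n. N (p ^ n)) \<longlonglongrightarrow> 0"
    by (rule N.null_comparison[of "\<lambda>n. N p ^ n"]) (simp_all add: LIMSEQ_realpow_zero N.nonneg p N_pow)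
  have le_ker: "norm (\<rho> a) \<le> N a" if "\<epsilon> a = 0" for a
    using le[of a] N.nonneg[of a] that by simp
  have diff: "norm (\<rho> (p ^ m) - \<rho> (p ^ n)) \<le> N (p ^ m - p ^ n)" for m n
    using le_ker[of "p ^ m - p ^ n"] by (simp add: star_rep_diff[OF \<rho>] clinear_diff[OF eps(1)] eps_pow)
  have "Cauchy (\<lambda>n. \<rho> (p ^ n))"
  proof (rule CauchyI)
    fix e :: real assume "0 < e"
    then obtain K where K: "\<And>n. n \<ge> K \<Longrightarrow> N (p ^ n) < e / 2"
      using order_tendstoD(2)[OF N_pow0, of "e / 2"] by (auto simp: eventually_sequentially)
    have "norm (\<rho> (p ^ m) - \<rho> (p ^ n)) < e" if "m \<ge> K" "n \<ge> K" for m n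
      using diff[of m n] N.triangle_minus[of "p ^ m" "p ^ n"] K[OF that(1)] K[OF that(2)] by linarith
    then show "\<exists>M. \<forall>m\<ge>M. \<forall>n\<ge>M. norm (\<rho> (p ^ m) - \<rho> (p ^ n)) < e" by blast
  qed
  then obtain P where P: "(\<lambda>n. \<rho> (p ^ n)) \<longlonglongrightarrow> P"
    using Cauchy_convergent_iff convergent_def by blast
  have Px: "(\<lambda>n. \<rho> (p ^ n) x) \<longlonglongrightarrow> P x" for x
    by (intro tendsto_intros P)
  have zero: "(\<lambda>n. norm (\<rho> (X n))) \<longlonglongrightarrow> 0"
    if "\<And>n. \<epsilon> (X n) = 0" "(\<lambda>n. N (X n)) \<longlonglongrightarrow> 0" for X :: "nat \<Rightarrow> 'a"
    by (rule Lim_null_comparison[OF _ that(2)]) (simp add: le_ker that(1))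
  have lin: "clinear (blinfun_apply P)"
    unfolding clinear_iff
  proof (intro conjI allI)
    show "P (x + y) = P x + P y" for x y by (rule blinfun.add_right)
    show "P (c *\<^sub>C x) = c *\<^sub>C P x" for c x
      using LIMSEQ_unique[OF Px[of "c *\<^sub>C x"]] tendsto_scaleC[OF Px[of x], of c]
      by (simp add: clinear_scale[OF r(1)])
  qed
  have lim_of_null: "(\<lambda>n. \<rho> (X n) x) \<longlonglongrightarrow> 0"
    if "\<And>n. \<epsilon> (X n) = 0" "(\<lambda>n. N (X n)) \<longlonglongrightarrow> 0" for X :: "nat \<Rightarrow> 'a" and x
  proof -
    have "(\<lambda>n. \<rho> (X n)) \<longlonglongrightarrow> 0" using zero[OF that] by (rule tendsto_norm_zero_cancel)
    from blinfun.tendsto[OF this tendsto_const, of x] show ?thesis by (simp add: blinfun.zero_left)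
  qed
  \<comment> \<open>Both \<open>b p\<^sup>n\<close> and \<open>p\<^sup>n b\<close> differ from \<open>\<epsilon> b p\<^sup>n\<close> by an element of the kernel of \<open>\<epsilon>\<close> that is small for \<open>N\<close>.\<close>
  have eig: "\<rho> b (P x) = \<epsilon> b *\<^sub>C P x" and eig': "P (\<rho> b x) = \<epsilon> b *\<^sub>C P x" for b x
  proof -
    have lim: "(\<lambda>n. \<epsilon> b *\<^sub>C \<rho> (p ^ n) x) \<longlonglongrightarrow> \<epsilon> b *\<^sub>C P x"
      by (rule tendsto_scaleC[OF Px])
    have N0: "(\<lambda>n. N (b * p ^ n - \<epsilon> b *\<^sub>C p ^ n)) \<longlonglongrightarrow> 0" "(\<lambda>n. N (p ^ n * b - \<epsilon> b *\<^sub>C p ^ n)) \<longlonglongrightarrow> 0"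
    proof -
      have *: "(\<lambda>n. (N b + cmod (\<epsilon> b)) * N (p ^ n)) \<longlonglongrightarrow> 0"
        by (rule tendsto_mult_right_zero[OF N_pow0])
      have "N (b * p ^ n - \<epsilon> b *\<^sub>C p ^ n) \<le> (N b + cmod (\<epsilon> b)) * N (p ^ n)"
        "N (p ^ n * b - \<epsilon> b *\<^sub>C p ^ n) \<le> (N b + cmod (\<epsilon> b)) * N (p ^ n)" for n
        using N.triangle_minus[of "b * p ^ n" "\<epsilon> b *\<^sub>C p ^ n"] N.triangle_minus[of "p ^ n * b" "\<epsilon> b *\<^sub>C p ^ n"]
          N.submult[of b "p ^ n"] N.submult[of "p ^ n" b] N.scale_le[of "\<epsilon> b" "p ^ n"]
        by (simp_all add: algebra_simps)
      then show "(\<lambda>n. N (b * p ^ n - \<epsilon> b *\<^sub>C p ^ n)) \<longlonglongrightarrow> 0" "(\<lambda>n. N (p ^ n * b - \<epsilon> b *\<^sub>C p ^ n)) \<longlonglongrightarrow> 0"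
        by (intro N.null_comparison[OF *]; simp)+
    qed
    have "(\<lambda>n. \<rho> (b * p ^ n - \<epsilon> b *\<^sub>C p ^ n) x) \<longlonglongrightarrow> 0"
      by (rule lim_of_null[OF _ N0(1)]) (simp add: clinear_diff[OF eps(1)] eps eps_scale eps_pow)
    then have "(\<lambda>n. \<rho> b (\<rho> (p ^ n) x) - \<epsilon> b *\<^sub>C \<rho> (p ^ n) x) \<longlonglongrightarrow> 0"
      by (simp add: star_rep_diff[OF \<rho>] blinfun.diff_left r(3,4))
    from tendsto_add[OF this lim] have "(\<lambda>n. \<rho> b (\<rho> (p ^ n) x)) \<longlonglongrightarrow> \<epsilon> b *\<^sub>C P x" by simp
    moreover have "(\<lambda>n. \<rho> b (\<rho> (p ^ n) x)) \<longlonglongrightarrow> \<rho> b (P x)"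
      by (intro tendsto_intros Px)
    ultimately show "\<rho> b (P x) = \<epsilon> b *\<^sub>C P x" by (rule LIMSEQ_unique[rotated])
    have "(\<lambda>n. \<rho> (p ^ n * b - \<epsilon> b *\<^sub>C p ^ n) x) \<longlonglongrightarrow> 0"
      by (rule lim_of_null[OF _ N0(2)]) (simp add: clinear_diff[OF eps(1)] eps eps_scale eps_pow)
    then have "(\<lambda>n. \<rho> (p ^ n) (\<rho> b x) - \<epsilon> b *\<^sub>C \<rho> (p ^ n) x) \<longlonglongrightarrow> 0"
      by (simp add: star_rep_diff[OF \<rho>] blinfun.diff_left r(3,4))
    from tendsto_add[OF this lim] have "(\<lambda>n. \<rho> (p ^ n) (\<rho> b x)) \<longlonglongrightarrow> \<epsilon> b *\<^sub>C P x" by simp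
    with Px[of "\<rho> b x"] show "P (\<rho> b x) = \<epsilon> b *\<^sub>C P x" by (rule LIMSEQ_unique)
  qed
  have idem: "P (P x) = P x" for x
    using Px[of "P x"] unfolding eig eps_pow scaleC_one by (simp add: LIMSEQ_const_iff)
  \<comment> \<open>The range of \<open>P\<close> is fixed pointwise by every \<open>\<rho> (star (p\<^sup>n))\<close>, whose adjoints \<open>\<rho> (p\<^sup>n)\<close> converge to \<open>P\<close>.\<close>
  have half_adj: "cinner x (P y) = cinner (P x) (P y)" for x y
  proof -
    have "cinner (\<rho> (p ^ n) x) (P y) = cinner x (P y)" for n
      using r(5)[of "star (p ^ n)" x "P y"] by (simp add: star_star eig eps eps_pow scaleC_one)
    then show ?thesis
      using tendsto_cinner_left[OF Px[of x], of "P y"] by (simp add: LIMSEQ_const_iff)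
  qed
  have adj: "cinner (P x) y = cinner x (P y)" for x y
    using half_adj[of y x] half_adj[of x y] cinner_commute[of "P x" y] cinner_commute[of "P x" "P y"] by simp
  have comm: "\<rho> a (P x) = P (\<rho> a x)" for a x by (simp add: eig eig')
  have "norm P \<le> 1"
  proof (rule LIMSEQ_le_const2[OF tendsto_norm[OF P]], intro exI allI impI)
    fix n
    have "N (p ^ n) \<le> 1" using N_pow[of n] power_le_one[of "N p" n] N.nonneg[of p] p(2) by linarith
    then show "norm (\<rho> (p ^ n)) \<le> 1" using le[of "p ^ n"] by (simp add: eps_pow)
  qed
  moreover have "star_rep (\<lambda>a. \<rho> a o\<^sub>L P)"
    by (rule star_rep_compose_projection[OF \<rho> lin idem adj comm])
  moreover have "star_rep (\<lambda>a. \<rho> a o\<^sub>L (id_blinfun - P))"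
  proof (rule star_rep_compose_projection[OF \<rho>])
    show "clinear (blinfun_apply (id_blinfun - P))"
      using lin by (simp add: clinear_iff blinfun.diff_left cvec.scale_right_diff_distrib)
  qed (simp_all add: blinfun.diff_left blinfun.diff_right idem comm adj cinner.diff_left cinner.diff_right)
  moreover have "norm (\<rho> a o\<^sub>L (id_blinfun - P)) \<le> N a" for a
  proof (rule norm_blinfun_bound[OF N.nonneg])
    fix x
    have "(\<lambda>n. \<rho> a x - \<epsilon> a *\<^sub>C \<rho> (p ^ n) x) \<longlonglongrightarrow> \<rho> a x - \<epsilon> a *\<^sub>C P x"
      by (intro tendsto_diff tendsto_const tendsto_scaleC Px)
    then have lim: "(\<lambda>n. norm (\<rho> (a - \<epsilon> a *\<^sub>C p ^ n) x)) \<longlonglongrightarrow> norm (blinfun_apply (\<rho> a o\<^sub>L (id_blinfun - P)) x)"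
      by (intro tendsto_norm) (simp add: star_rep_diff[OF \<rho>] blinfun.diff_left blinfun.diff_right r(3) eig)
    have "(\<lambda>n. (N a + cmod (\<epsilon> a) * N (p ^ n)) * norm x) \<longlonglongrightarrow> (N a + cmod (\<epsilon> a) * 0) * norm x"
      by (intro tendsto_intros N_pow0)
    moreover have "norm (\<rho> (a - \<epsilon> a *\<^sub>C p ^ n) x) \<le> (N a + cmod (\<epsilon> a) * N (p ^ n)) * norm x" for n
    proof -
      have "norm (\<rho> (a - \<epsilon> a *\<^sub>C p ^ n)) \<le> N (a - \<epsilon> a *\<^sub>C p ^ n)"
        by (rule le_ker) (simp add: clinear_diff[OF eps(1)] eps_scale eps_pow)
      also have "\<dots> \<le> N a + cmod (\<epsilon> a) * N (p ^ n)"
        by (intro order_trans[OF N.triangle_minus] add_mono N.scale_le order_refl)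
      finally show ?thesis
        by (intro order_trans[OF norm_blinfun] mult_right_mono) simp_all
    qed
    ultimately show "norm (blinfun_apply (\<rho> a o\<^sub>L (id_blinfun - P)) x) \<le> N a * norm x"
      using LIMSEQ_le[OF lim] by auto
  qed
  ultimately show thesis
    using lin eig by (intro that) (auto simp: contractive_rep_def)
qed

lemma tensor_rep_split_left:
  assumes \<rho>: "star_rep \<rho>" "star_rep \<rho>1" "star_rep \<rho>2" and \<sigma>: "star_rep \<sigma>"
    and split: "\<And>a x. blinfun_apply (\<rho> a) x = \<rho>1 a x + \<rho>2 a x"
  shows "tensor_rep \<rho> \<sigma> t u = tensor_rep \<rho>1 \<sigma> t u + tensor_rep \<rho>2 \<sigma> t u"
proof (induction t rule: tensor_induct)
  case (tens a b)
  note lin = tensor_rep_zero[OF _ \<sigma>] tensor_rep_add[OF _ \<sigma>]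
  show ?case
    by (induction u rule: tensor_induct)
      (simp_all add: lin \<rho> tensor_rep_tens_tens[OF _ \<sigma>] split tens_add_left)
qed (simp_all add: tensor_rep_zero[OF _ \<sigma>] tensor_rep_add[OF _ \<sigma>] \<rho>)

lemma tensor_rep_split_right:
  assumes \<rho>: "star_rep \<rho>" and \<sigma>: "star_rep \<sigma>" "star_rep \<sigma>1" "star_rep \<sigma>2"
    and split: "\<And>b y. blinfun_apply (\<sigma> b) y = \<sigma>1 b y + \<sigma>2 b y"
  shows "tensor_rep \<rho> \<sigma> t u = tensor_rep \<rho> \<sigma>1 t u + tensor_rep \<rho> \<sigma>2 t u"
proof (induction t rule: tensor_induct)
  case (tens a b)
  note lin = tensor_rep_zero[OF \<rho>] tensor_rep_add[OF \<rho>]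
  show ?case
    by (induction u rule: tensor_induct)
      (simp_all add: lin \<sigma> tensor_rep_tens_tens[OF \<rho>] split tens_add_right)
qed (simp_all add: tensor_rep_zero[OF \<rho>] tensor_rep_add[OF \<rho>] \<sigma>)

text \<open>
  When one factor is a multiple of a character \<open>\<epsilon>\<close>, only the slice \<open>(\<epsilon> \<otimes> id) t\<close> matters. For the
  counit and \<open>t = \<Delta> a\<close> this slice is \<open>a\<close> itself.
\<close>

lemma tensor_rep_character_left:
  assumes \<rho>: "star_rep \<rho>" and \<sigma>: "star_rep \<sigma>" and \<epsilon>: "clinear \<epsilon>" and P: "clinear (blinfun_apply P)"
    and char: "\<And>a x. blinfun_apply (\<rho> a) x = \<epsilon> a *\<^sub>C P x"
  shows "tensor_rep \<rho> \<sigma> t u = tensor_map (blinfun_apply P) (blinfun_apply (\<sigma> (tensor_lift (\<lambda>a b. \<epsilon> a *\<^sub>C b) t))) u"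
proof (rule clinear_eq_on_tens[OF clinear_tensor_rep[OF \<rho> \<sigma>] clinear_tensor_map(1)[OF P star_repD(1)[OF \<sigma>]]])
  fix x y
  have *: "balanced (\<lambda>a b. \<epsilon> a *\<^sub>C b)"
    by (simp add: balanced_def clinear_add[OF \<epsilon>] clinear_scale[OF \<epsilon>] scaleC_complex_def scaleC_add_left
        scaleC_add_right scaleC_scaleC mult.commute)
  have lift: "clinear (tensor_lift (\<lambda>a b. \<epsilon> a *\<^sub>C b))"
    by (rule tensor_lift_clinear[OF *]) (simp add: clinear_scale[OF \<epsilon>] scaleC_complex_def scaleC_scaleC)
  have "tensor_rep \<rho> \<sigma> t (x \<otimes> y) = P x \<otimes> \<sigma> (tensor_lift (\<lambda>a b. \<epsilon> a *\<^sub>C b) t) y"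
  proof (rule clinear_eq_on_tens[OF clinear_tensor_rep_left[OF \<rho> \<sigma>]])
    show "clinear (\<lambda>t. P x \<otimes> \<sigma> (tensor_lift (\<lambda>a b. \<epsilon> a *\<^sub>C b) t) y)"
      by (simp add: clinear_iff clinear_add[OF lift] clinear_scale[OF lift] star_repD[OF \<sigma>]
          blinfun.add_left tens_add_right tens_scale_right)
  qed (simp add: tensor_rep_tens_tens[OF \<rho> \<sigma>] char tensor_lift_tens[OF *] star_repD(3)[OF \<sigma>]
      tens_scale_left tens_scale_right)
  then show "tensor_rep \<rho> \<sigma> t (x \<otimes> y) =
      tensor_map (blinfun_apply P) (blinfun_apply (\<sigma> (tensor_lift (\<lambda>a b. \<epsilon> a *\<^sub>C b) t))) (x \<otimes> y)"
    by (simp add: clinear_tensor_map(2)[OF P star_repD(1)[OF \<sigma>]])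
qed

lemma tensor_rep_character_right:
  assumes \<rho>: "star_rep \<rho>" and \<sigma>: "star_rep \<sigma>" and \<epsilon>: "clinear \<epsilon>" and Q: "clinear (blinfun_apply Q)"
    and char: "\<And>b y. blinfun_apply (\<sigma> b) y = \<epsilon> b *\<^sub>C Q y"
  shows "tensor_rep \<rho> \<sigma> t u = tensor_map (blinfun_apply (\<rho> (tensor_lift (\<lambda>a b. \<epsilon> b *\<^sub>C a) t))) (blinfun_apply Q) u"
proof (rule clinear_eq_on_tens[OF clinear_tensor_rep[OF \<rho> \<sigma>] clinear_tensor_map(1)[OF star_repD(1)[OF \<rho>] Q]])
  fix x y
  have *: "balanced (\<lambda>a b. \<epsilon> b *\<^sub>C a)"
    by (simp add: balanced_def clinear_add[OF \<epsilon>] clinear_scale[OF \<epsilon>] scaleC_complex_def scaleC_add_left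
        scaleC_add_right scaleC_scaleC mult.commute)
  have lift: "clinear (tensor_lift (\<lambda>a b. \<epsilon> b *\<^sub>C a))"
    by (rule tensor_lift_clinear[OF *]) (simp add: scaleC_scaleC mult.commute)
  have "tensor_rep \<rho> \<sigma> t (x \<otimes> y) = \<rho> (tensor_lift (\<lambda>a b. \<epsilon> b *\<^sub>C a) t) x \<otimes> Q y"
  proof (rule clinear_eq_on_tens[OF clinear_tensor_rep_left[OF \<rho> \<sigma>]])
    show "clinear (\<lambda>t. \<rho> (tensor_lift (\<lambda>a b. \<epsilon> b *\<^sub>C a) t) x \<otimes> Q y)"
      by (simp add: clinear_iff clinear_add[OF lift] clinear_scale[OF lift] star_repD[OF \<rho>]
          blinfun.add_left tens_add_left tens_scale_left)
  qed (simp add: tensor_rep_tens_tens[OF \<rho> \<sigma>] char tensor_lift_tens[OF *] star_repD(3)[OF \<rho>]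
      tens_scale_left tens_scale_right)
  then show "tensor_rep \<rho> \<sigma> t (x \<otimes> y) =
      tensor_map (blinfun_apply (\<rho> (tensor_lift (\<lambda>a b. \<epsilon> b *\<^sub>C a) t))) (blinfun_apply Q) (x \<otimes> y)"
    by (simp add: clinear_tensor_map(2)[OF star_repD(1)[OF \<rho>] Q])
qed

section \<open>Adding the counit to a quantum group norm\<close>

lemma cstar_norm_max_character:
  fixes N :: "'a::complex_star_algebra \<Rightarrow> real" and \<epsilon> :: "'a \<Rightarrow> complex"
  assumes "cstar_norm N" and eps: "clinear \<epsilon>" "\<And>a b. \<epsilon> (a * b) = \<epsilon> a * \<epsilon> b"
    "\<And>a. \<epsilon> (star a) = cnj (\<epsilon> a)"
  shows "cstar_norm (\<lambda>a. max (N a) (cmod (\<epsilon> a)))"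
proof -
  note N = cstar_normD[OF assms(1)]
  show ?thesis
    unfolding cstar_norm_def
  proof (intro conjI allI)
    fix a b c
    show "0 \<le> max (N a) (cmod (\<epsilon> a))" by (simp add: le_max_iff_disj)
    show "(max (N a) (cmod (\<epsilon> a)) = 0) = (a = 0)"
      using N(1,2)[of a] clinear_zero[OF eps(1)] by (auto simp: max_def)
    show "max (N (a + b)) (cmod (\<epsilon> (a + b))) \<le> max (N a) (cmod (\<epsilon> a)) + max (N b) (cmod (\<epsilon> b))"
      using N(3)[of a b] norm_triangle_ineq[of "\<epsilon> a" "\<epsilon> b"]
      unfolding clinear_add[OF eps(1)] by linarith
    show "max (N (c *\<^sub>C a)) (cmod (\<epsilon> (c *\<^sub>C a))) = cmod c * max (N a) (cmod (\<epsilon> a))"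
      by (simp add: N(4) clinear_scale[OF eps(1)] scaleC_complex_def norm_mult max_mult_distrib_left)
    have "N (a * b) \<le> max (N a) (cmod (\<epsilon> a)) * max (N b) (cmod (\<epsilon> b))"
      by (rule order_trans[OF N(5)]) (intro mult_mono, simp_all add: N(1) le_max_iff_disj)
    moreover have "cmod (\<epsilon> (a * b)) \<le> max (N a) (cmod (\<epsilon> a)) * max (N b) (cmod (\<epsilon> b))"
      unfolding eps norm_mult by (intro mult_mono) (simp_all add: N(1) le_max_iff_disj)
    ultimately show "max (N (a * b)) (cmod (\<epsilon> (a * b))) \<le> max (N a) (cmod (\<epsilon> a)) * max (N b) (cmod (\<epsilon> b))"
      by simp
    have "(max x y)\<^sup>2 = max (x\<^sup>2) (y\<^sup>2)" if "0 \<le> x" "0 \<le> y" for x y :: real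
      using that by (auto simp: max_def dest: power2_le_imp_le power_mono)
    then show "max (N (star a * a)) (cmod (\<epsilon> (star a * a))) = (max (N a) (cmod (\<epsilon> a)))\<^sup>2"
      by (simp add: N(1) N(6) eps norm_mult power2_eq_square)
  qed
qed

lemma norm_sum_character:
  "norm (sum_character \<pi> \<epsilon> a) = max (norm (\<pi> a)) (cmod (\<epsilon> a))" (is "_ = ?m")
proof (rule antisym)
  show "norm (sum_character \<pi> \<epsilon> a) \<le> ?m"
  proof (rule norm_blinfun_bound)
    fix v :: "'a \<times> complex"
    obtain x z where v: "v = (x, z)" by (cases v)
    have "(norm (blinfun_apply (\<pi> a) x))\<^sup>2 + (cmod (\<epsilon> a * z))\<^sup>2 \<le> (?m * norm x)\<^sup>2 + (?m * cmod z)\<^sup>2"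
      unfolding norm_mult
      by (intro add_mono power_mono order_trans[OF norm_blinfun] mult_right_mono) (simp_all add: mult_nonneg_nonneg)
    also have "\<dots> = ?m\<^sup>2 * ((norm x)\<^sup>2 + (cmod z)\<^sup>2)"
      by (simp add: power_mult_distrib distrib_left)
    finally have "sqrt ((norm (blinfun_apply (\<pi> a) x))\<^sup>2 + (cmod (\<epsilon> a * z))\<^sup>2)
        \<le> sqrt (?m\<^sup>2 * ((norm x)\<^sup>2 + (cmod z)\<^sup>2))"
      by (rule real_sqrt_le_mono)
    moreover have "\<bar>?m\<bar> = ?m" by (simp add: le_max_iff_disj)
    ultimately show "norm (blinfun_apply (sum_character \<pi> \<epsilon> a) v) \<le> ?m * norm v"
      by (simp only: v sum_character_apply norm_Pair real_sqrt_mult real_sqrt_abs)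
  qed (simp add: le_max_iff_disj)
  have "norm (\<pi> a) \<le> norm (sum_character \<pi> \<epsilon> a)"
  proof (rule norm_blinfun_bound)
    show "norm (blinfun_apply (\<pi> a) x) \<le> norm (sum_character \<pi> \<epsilon> a) * norm x" for x
      using norm_blinfun[of "sum_character \<pi> \<epsilon> a" "(x, 0)"] by (simp add: sum_character_apply norm_Pair)
  qed simp
  moreover have "cmod (\<epsilon> a) \<le> norm (sum_character \<pi> \<epsilon> a)"
    using norm_blinfun[of "sum_character \<pi> \<epsilon> a" "(0, 1)"] by (simp add: sum_character_apply norm_Pair)
  ultimately show "?m \<le> norm (sum_character \<pi> \<epsilon> a)" by simp
qed

text \<open>
  Unless \<open>|\<epsilon>| \<le> N\<close>, in which case the norm does not change, the character can be split off from both
  representations: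
  \<open>\<rho> \<otimes> \<sigma> = \<rho>1 \<otimes> \<sigma>1 + \<rho>2 \<otimes> \<sigma>1 + \<rho> \<otimes> \<sigma>2\<close> with \<open>\<rho>1\<close>, \<open>\<sigma>1\<close> contractive for \<open>N\<close> and \<open>\<rho>2 = \<epsilon> P\<close>, \<open>\<sigma>2 = \<epsilon> Q\<close>. At \<open>\<Delta> a\<close>
  the first summand is bounded by the assumption on \<open>N\<close>, and the counit identities turn the other two
  into \<open>P \<otimes> \<sigma>1 a\<close> and \<open>\<rho> a \<otimes> Q\<close>.
\<close>

lemma quantum_group_norm_max_counit:
  assumes hopf: "hopf_star_algebra \<Delta> \<epsilon> S" and qN: "quantum_group_norm \<Delta> N"
  shows "quantum_group_norm \<Delta> (\<lambda>a. max (N a) (cmod (\<epsilon> a)))" (is "quantum_group_norm \<Delta> ?N'")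
proof -
  interpret hopf_star_algebra \<Delta> \<epsilon> S by (rule hopf)
  have cN: "cstar_norm N" using qN by (simp add: quantum_group_norm_def)
  note N = cstar_normD[OF cN]
  have cN': "cstar_norm ?N'"
    by (rule cstar_norm_max_character[OF cN counit_clinear counit_mult counit_star])
  note N' = cstar_normD[OF cN']
  show ?thesis
  proof (cases "\<forall>a. cmod (\<epsilon> a) \<le> N a")
    case True
    then have "?N' = N" by (simp add: max_absorb1)
    then show ?thesis using qN by simp
  next
    case False
    then obtain a where a: "N a < cmod (\<epsilon> a)" by (auto simp: not_le)
    define p where "p = (1 / \<epsilon> a) *\<^sub>C a"
    have "\<epsilon> a \<noteq> 0" using a N(1)[of a] by auto
    then have p: "\<epsilon> p = 1" "N p < 1"
      using a by (simp_all add: p_def clinear_scale[OF counit_clinear] scaleC_complex_def N(4) norm_divide)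
    have bound: "tensor_norm (tensor_rep \<rho> \<sigma> (\<Delta> a) u) \<le> 3 * ?N' a * tensor_norm u"
      if r: "contractive_rep ?N' \<rho>" "contractive_rep ?N' \<sigma>"
      for \<rho> \<sigma> :: "'a \<Rightarrow> ('a ell2 \<Rightarrow>\<^sub>L 'a ell2)" and a u
    proof -
      have \<rho>: "star_rep \<rho>" "norm (\<rho> b) \<le> ?N' b" and \<sigma>: "star_rep \<sigma>" for b
        using r by (auto simp: contractive_rep_def)
      obtain P where P: "clinear (blinfun_apply P)" "norm P \<le> 1"
        "\<forall>a x. blinfun_apply (\<rho> a) (P x) = \<epsilon> a *\<^sub>C P x"
        "star_rep (\<lambda>a. \<rho> a o\<^sub>L P)" "contractive_rep N (\<lambda>a. \<rho> a o\<^sub>L (id_blinfun - P))"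
        by (rule split_off_character[OF cN counit_clinear counit_mult counit_one counit_star r(1) p])
      obtain Q where Q: "clinear (blinfun_apply Q)" "norm Q \<le> 1"
        "\<forall>a x. blinfun_apply (\<sigma> a) (Q x) = \<epsilon> a *\<^sub>C Q x"
        "star_rep (\<lambda>a. \<sigma> a o\<^sub>L Q)" "contractive_rep N (\<lambda>a. \<sigma> a o\<^sub>L (id_blinfun - Q))"
        by (rule split_off_character[OF cN counit_clinear counit_mult counit_one counit_star r(2) p])
      define \<rho>1 \<rho>2 \<sigma>1 \<sigma>2 where "\<rho>1 = (\<lambda>a. \<rho> a o\<^sub>L (id_blinfun - P))" and "\<rho>2 = (\<lambda>a. \<rho> a o\<^sub>L P)"
        and "\<sigma>1 = (\<lambda>a. \<sigma> a o\<^sub>L (id_blinfun - Q))" and "\<sigma>2 = (\<lambda>a. \<sigma> a o\<^sub>L Q)"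
      note defs = \<rho>1_def \<rho>2_def \<sigma>1_def \<sigma>2_def
      have c1: "contractive_rep N \<rho>1" "contractive_rep N \<sigma>1"
        using P(5) Q(5) by (simp_all add: defs)
      then have s1: "star_rep \<rho>1" "star_rep \<sigma>1" "norm (\<sigma>1 b) \<le> N b" for b
        by (auto simp: contractive_rep_def)
      have s2: "star_rep \<rho>2" "star_rep \<sigma>2" using P(4) Q(4) by (simp_all add: defs)
      have "tensor_rep \<rho> \<sigma> (\<Delta> a) u = tensor_rep \<rho> \<sigma>1 (\<Delta> a) u + tensor_rep \<rho> \<sigma>2 (\<Delta> a) u"
        by (rule tensor_rep_split_right[OF \<rho>(1) \<sigma> s1(2) s2(2)]) (simp add: defs blinfun.diff_left blinfun.diff_right)
      also have "tensor_rep \<rho> \<sigma>1 (\<Delta> a) u = tensor_rep \<rho>1 \<sigma>1 (\<Delta> a) u + tensor_rep \<rho>2 \<sigma>1 (\<Delta> a) u"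
        by (rule tensor_rep_split_left[OF \<rho>(1) s1(1) s2(1) s1(2)]) (simp add: defs blinfun.diff_left blinfun.diff_right)
      also have "tensor_rep \<rho>2 \<sigma>1 (\<Delta> a) u = tensor_map P (\<sigma>1 a) u"
        using tensor_rep_character_left[OF s2(1) s1(2) counit_clinear P(1), of "\<Delta> a" u]
        by (simp add: defs P(3) counit_left)
      also have "tensor_rep \<rho> \<sigma>2 (\<Delta> a) u = tensor_map (\<rho> a) Q u"
        using tensor_rep_character_right[OF \<rho>(1) s2(2) counit_clinear Q(1), of "\<Delta> a" u]
        by (simp add: defs Q(3) counit_right)
      finally have "tensor_norm (tensor_rep \<rho> \<sigma> (\<Delta> a) u) \<le>
          tensor_norm (tensor_rep \<rho>1 \<sigma>1 (\<Delta> a) u) + tensor_norm (tensor_map P (\<sigma>1 a) u)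
          + tensor_norm (tensor_map (\<rho> a) Q u)"
        by (simp only:) (intro order_trans[OF tensor_norm_triangle] add_right_mono tensor_norm_triangle)
      moreover have "tensor_norm (tensor_rep \<rho>1 \<sigma>1 (\<Delta> a) u) \<le> N a * tensor_norm u"
        by (rule quantum_group_norm_comult_bound[OF qN comult_clinear comult_mult comult_star comult_one c1])
      moreover have "tensor_norm (tensor_map P (\<sigma>1 a) u) \<le> 1 * N a * tensor_norm u"
        by (intro order_trans[OF tensor_norm_map] mult_right_mono mult_mono P(1,2) star_repD(1) s1
            tensor_norm_ge_0) simp_all
      moreover have "tensor_norm (tensor_map (\<rho> a) Q u) \<le> ?N' a * 1 * tensor_norm u"
        by (intro order_trans[OF tensor_norm_map] mult_right_mono mult_mono Q(1,2) star_repD(1) \<rho>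
            tensor_norm_ge_0 N'(1)) simp_all
      moreover have "N a * tensor_norm u \<le> ?N' a * tensor_norm u"
        by (intro mult_right_mono tensor_norm_ge_0) simp
      ultimately show ?thesis by (simp add: algebra_simps)
    qed
    have "spatial_norm ?N' ?N' (\<Delta> a) \<le> 3 * ?N' a" for a
      by (rule spatial_norm_le[OF N'(1) N'(1) _ bound]) (simp_all add: N'(1))
    then show ?thesis
      unfolding quantum_group_norm_def
      by (intro conjI cN' completion_star_hom_extension star_seminorm_cstar_norm[OF cN']
          star_seminorm_spatial_norm N'(1) comult_clinear comult_mult comult_star)
  qed
qed

theorem proposition8p1:
  fixes \<Delta> :: "'a::complex_star_algebra \<Rightarrow> ('a, 'a) tensor"
    and \<epsilon> :: "'a \<Rightarrow> complex"
    and S :: "'a \<Rightarrow> 'a"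
    and N :: "'a \<Rightarrow> real"
    and \<pi> :: "'a \<Rightarrow> ('h::chilbert_space \<Rightarrow>\<^sub>L 'h)"
  assumes "compact_quantum_group \<Delta> \<epsilon> S"
    and "quantum_group_norm \<Delta> N"
    and "star_rep \<pi>"
    and "\<And>a. norm (\<pi> a) = N a"
  shows "(\<forall>a. norm (sum_character \<pi> \<epsilon> a) = max (norm (\<pi> a)) (cmod (\<epsilon> a)))
    \<and> quantum_group_norm \<Delta> (\<lambda>a. norm (sum_character \<pi> \<epsilon> a))"
proof (intro conjI allI)
  show "norm (sum_character \<pi> \<epsilon> a) = max (norm (\<pi> a)) (cmod (\<epsilon> a))" for a
    by (rule norm_sum_character)
  have "hopf_star_algebra \<Delta> \<epsilon> S"
    using assms(1) by (rule compact_quantum_group.axioms(1))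
  then show "quantum_group_norm \<Delta> (\<lambda>a. norm (sum_character \<pi> \<epsilon> a))"
    unfolding norm_sum_character assms(4) using assms(2) by (rule quantum_group_norm_max_counit)
qed

end
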